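(* Let $A$ be a ring that is not local, let $E$ be an $A$-module, let $R=A\propto E$ and let $n$ be a positive integer. Then $R$ is an $n$-OAF-ring if and only if $A$ is a general ZPI-ring and either $E$ is cyclic with $\mathrm{ann}(E)=P_1P_2\cdots P_s$ for some idempotent maximal ideals $P_1,P_2,\ldots,P_s$ of $A$, or $E=0$ (if $s=0$, then $\mathrm{ann}(E)=A$).
   Context: All rings are commutative with $1\neq 0$. A local ring is a ring with a unique maximal ideal (not assumed Noetherian). The trivial extension $A\propto E$ is the additive group $A\oplus E$ with multiplication $(a,e)(b,f)=(ab,af+be)$. An ideal $P$ is idempotent if $P^2=P$; $\mathrm{ann}(E)=\{a\in A: aE=0\}$. A general ZPI-ring is a ring in which every proper ideal is a product of finitely many prime ideals. A proper ideal $I$ of a ring $R$ is an $n$-OA ideal if whenever $a_1a_2\cdots a_{n+1}\in I$ for nonunits $a_1,\ldots,a_{n+1}\in R$, then $a_1a_2\cdots a_n\in I$ or $a_{n+1}\in I$. A ring $R$ is an $n$-OAF-ring if every proper ideal of $R$ is a product of finitely many $n$-OA ideals of $R$. *)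

theory Defs
  imports "HOL-Algebra.Ideal_Product" "HOL-Algebra.Module"
begin

definition local_ring :: "('a, 'm) ring_scheme \<Rightarrow> bool" where
  "local_ring R \<longleftrightarrow> cring R \<and> (\<exists>!M. maximalideal M R)"

definition proper_ideal :: "'a set \<Rightarrow> ('a, 'm) ring_scheme \<Rightarrow> bool" where
  "proper_ideal I R \<longleftrightarrow> ideal I R \<and> I \<noteq> carrier R"

text \<open>The empty product of ideals is the unit ideal; in particular a proper ideal
  is never an empty product.\<close>

definition ideal_prod_list :: "('a, 'm) ring_scheme \<Rightarrow> 'a set list \<Rightarrow> 'a set" where
  "ideal_prod_list R Is = foldr (ideal_prod R) Is (carrier R)"

definition idempotent_ideal :: "'a set \<Rightarrow> ('a, 'm) ring_scheme \<Rightarrow> bool" where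
  "idempotent_ideal P R \<longleftrightarrow> ideal P R \<and> P \<cdot>\<^bsub>R\<^esub> P = P"

definition general_ZPI_ring :: "('a, 'm) ring_scheme \<Rightarrow> bool" where
  "general_ZPI_ring R \<longleftrightarrow> cring R \<and> \<one>\<^bsub>R\<^esub> \<noteq> \<zero>\<^bsub>R\<^esub> \<and>
     (\<forall>I. proper_ideal I R \<longrightarrow>
        (\<exists>Ps. (\<forall>P\<in>set Ps. primeideal P R) \<and> I = ideal_prod_list R Ps))"

definition n_OA_ideal :: "nat \<Rightarrow> 'a set \<Rightarrow> ('a, 'm) ring_scheme \<Rightarrow> bool" where
  "n_OA_ideal n I R \<longleftrightarrow> proper_ideal I R \<and>
     (\<forall>a :: nat \<Rightarrow> 'a.
        (\<forall>i\<in>{1..n+1}. a i \<in> carrier R - Units R) \<longrightarrow>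
        (\<Otimes>\<^bsub>R\<^esub>i\<in>{1..n+1}. a i) \<in> I \<longrightarrow>
        (\<Otimes>\<^bsub>R\<^esub>i\<in>{1..n}. a i) \<in> I \<or> a (n+1) \<in> I)"

definition n_OAF_ring :: "nat \<Rightarrow> ('a, 'm) ring_scheme \<Rightarrow> bool" where
  "n_OAF_ring n R \<longleftrightarrow> cring R \<and> \<one>\<^bsub>R\<^esub> \<noteq> \<zero>\<^bsub>R\<^esub> \<and>
     (\<forall>I. proper_ideal I R \<longrightarrow>
        (\<exists>Js. (\<forall>J\<in>set Js. n_OA_ideal n J R) \<and> I = ideal_prod_list R Js))"

text \<open>In the following definitions the fields \<open>mult\<close> and \<open>one\<close> that the record type
  of modules inherits from rings are never used.\<close>

definition trivial_extension ::
    "('a, 'm) ring_scheme \<Rightarrow> ('a, 'b, 'k) module_scheme \<Rightarrow> ('a \<times> 'b) ring" where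
  "trivial_extension A E =
     \<lparr> carrier = carrier A \<times> carrier E,
       mult = (\<lambda>(a, e) (b, f). (a \<otimes>\<^bsub>A\<^esub> b, (a \<odot>\<^bsub>E\<^esub> f) \<oplus>\<^bsub>E\<^esub> (b \<odot>\<^bsub>E\<^esub> e))),
       one = (\<one>\<^bsub>A\<^esub>, \<zero>\<^bsub>E\<^esub>),
       zero = (\<zero>\<^bsub>A\<^esub>, \<zero>\<^bsub>E\<^esub>),
       add = (\<lambda>(a, e) (b, f). (a \<oplus>\<^bsub>A\<^esub> b, e \<oplus>\<^bsub>E\<^esub> f)) \<rparr>"

definition cyclic_module :: "('a, 'm) ring_scheme \<Rightarrow> ('a, 'b, 'k) module_scheme \<Rightarrow> bool" where
  "cyclic_module A E \<longleftrightarrow>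
     module A E \<and> (\<exists>x\<in>carrier E. carrier E = {a \<odot>\<^bsub>E\<^esub> x | a. a \<in> carrier A})"

definition annihilator :: "('a, 'm) ring_scheme \<Rightarrow> ('a, 'b, 'k) module_scheme \<Rightarrow> 'a set" where
  "annihilator A E = {a \<in> carrier A. \<forall>e\<in>carrier E. a \<odot>\<^bsub>E\<^esub> e = \<zero>\<^bsub>E\<^esub>}"

lemma trivial_extension_cring:
  assumes "module A E"
  shows "cring (trivial_extension A E)"
proof -
  interpret module A E by fact
  let ?R = "trivial_extension A E"
  note d = trivial_extension_def
  show ?thesis
  proof (rule cringI)
    show "abelian_group ?R"
    proof (rule abelian_groupI)
      fix x assume "x \<in> carrier ?R"
      then have "(\<ominus>\<^bsub>A\<^esub> fst x, \<ominus>\<^bsub>E\<^esub> snd x) \<in> carrier ?R"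
        and "(\<ominus>\<^bsub>A\<^esub> fst x, \<ominus>\<^bsub>E\<^esub> snd x) \<oplus>\<^bsub>?R\<^esub> x = \<zero>\<^bsub>?R\<^esub>"
        by (auto simp: d R.l_neg M.l_neg)
      then show "\<exists>y\<in>carrier ?R. y \<oplus>\<^bsub>?R\<^esub> x = \<zero>\<^bsub>?R\<^esub>" by blast
    qed (auto simp: d R.add.m_ac M.add.m_ac)
    show "Group.comm_monoid ?R"
      by (rule comm_monoidI)
        (auto simp: d R.m_ac smult_r_distr smult_assoc1[symmetric] M.a_assoc
          intro: M.a_comm)
    show "(x \<oplus>\<^bsub>?R\<^esub> y) \<otimes>\<^bsub>?R\<^esub> z = x \<otimes>\<^bsub>?R\<^esub> z \<oplus>\<^bsub>?R\<^esub> y \<otimes>\<^bsub>?R\<^esub> z"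
      if "x \<in> carrier ?R" "y \<in> carrier ?R" "z \<in> carrier ?R" for x y z
      using that by (auto simp: d R.l_distr smult_l_distr smult_r_distr M.add.m_ac)
  qed
qed

end

theory Submission
  imports Defs "HOL-Algebra.QuotRing"
begin

text \<open>
  Write \<open>T\<close> for the trivial extension of the ring \<open>A\<close> by the module \<open>E\<close>. Since \<open>A\<close> is not
  local, 1 is a sum of two nonunits of \<open>A\<close>, hence also of \<open>T\<close>. This lets one lower the number
  of factors in the definition of an OA ideal one at a time, so that the OA ideals of \<open>T\<close> are
  exactly its prime ideals (\<open>n_OA_ideal_iff_prime\<close>), and the question becomes when \<open>T\<close> is a
  general ZPI-ring.

  What is needed about a general ZPI-ring follows from one identity: if \<open>Q\<close> is prime and \<open>a\<close> is
  not in \<open>Q\<close>, then \<open>Q = Q(Q + (a))\<close> (\<open>ZPI_prime_absorbs_sum\<close>). It holds because \<open>(Q + (a))\<^sup>2\<close> and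
  \<open>Q + (a\<^sup>2)\<close> agree modulo \<open>Q\<close>, where they are principal and nonzero, and such an ideal of a
  domain has only one prime factorization. It follows that a prime \<open>Q\<close> strictly inside an ideal
  \<open>M\<close> satisfies \<open>QM = Q\<close>, and, by factoring the principal ideal of \<open>x\<close>, that each \<open>x\<close> in \<open>Q\<close> has
  the form \<open>xm\<close> with \<open>m\<close> in \<open>M\<close>: the prime \<open>Q\<close> vanishes locally at \<open>M\<close>. The same argument shows
  that an idempotent maximal ideal is a minimal prime, and then a factorization of the zero ideal
  shows that it is generated by an idempotent.

  Suppose that \<open>T\<close> is a general ZPI-ring. Its image \<open>A\<close> is one too. Every prime of \<open>T\<close> contains the
  square-zero ideal \<open>0 \<times> E\<close>, so the primes of \<open>T\<close> are the ideals \<open>P \<times> E\<close> with \<open>P\<close> prime in \<open>A\<close>. Let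
  \<open>N\<close> be a maximal ideal of \<open>A\<close>. If \<open>N\<close> is not a minimal prime, then \<open>E\<close> vanishes locally at \<open>N\<close>,
  because \<open>0 \<times> E\<close> lies in a prime strictly inside \<open>N \<times> E\<close>. If \<open>N\<close> is minimal, then the ideals of
  \<open>T\<close> are, locally at \<open>N \<times> E\<close>, powers of \<open>N \<times> E\<close>; applied to \<open>0 \<times> E\<close> and to its cyclic submodules,
  this shows that \<open>E\<close> is locally zero or that \<open>N\<close> is generated by an idempotent \<open>e\<close> and
  \<open>(1 - e)E\<close> is at most one-dimensional over \<open>A/N\<close> (\<open>ZPI_T_minimal_dichotomy\<close>). Only finitely
  many \<open>N\<close> give a nonzero localization, as each of them is a factor of the zero ideal. An element of
  \<open>E\<close> that is nonzero locally at each of them generates \<open>E\<close>, and the annihilator of \<open>E\<close> is their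
  product (\<open>ZPI_T_imp_cyclic\<close>).

  Conversely, let \<open>E\<close> be cyclic with the annihilator \<open>P\<^sub>1 \<dots> P\<^sub>s\<close>, where \<open>P\<^sub>i\<close> is maximal and generated
  by an idempotent \<open>e\<^sub>i\<close>. An idempotent \<open>p\<close> splits every ideal as \<open>J = (J + (p))(J + (1 - p))\<close>. With
  \<open>p = (1 - e\<^sub>i, 0)\<close> the second factor contains \<open>(e\<^sub>i, 0)\<close>, and is therefore \<open>T\<close>, \<open>P\<^sub>i \<times> E\<close> or the
  square of \<open>P\<^sub>i \<times> E\<close>. Once all the \<open>p\<close> have been added, the remaining ideal contains \<open>0 \<times> E\<close> and comes
  from an ideal of \<open>A\<close>, whose factorization lifts to \<open>T\<close> (\<open>cyclic_imp_ZPI_T\<close>). The case \<open>E = 0\<close>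
  is the cyclic case with \<open>s = 0\<close>.
\<close>

(* The disjoint sum of sets would make sums of ideals ambiguous. *)
no_notation Sum_Type.Plus (infixr \<open><+>\<close> 65)

section \<open>Products of ideals\<close>

context cring
begin

lemma ideal_prod_subset:
  assumes "ideal K R" and "\<And>i j. i \<in> I \<Longrightarrow> j \<in> J \<Longrightarrow> i \<otimes> j \<in> K"
  shows "I \<cdot> J \<subseteq> K"
proof
  fix x assume "x \<in> I \<cdot> J"
  then show "x \<in> K"
    by induct (auto intro: assms additive_subgroup.a_closed[OF ideal.axioms(1)[OF assms(1)]])
qed

lemma ideal_prod_mono:
  assumes "I \<subseteq> I'" and "J \<subseteq> J'"
  shows "I \<cdot> J \<subseteq> I' \<cdot> J'"
proof
  fix x assume "x \<in> I \<cdot> J"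
  then show "x \<in> I' \<cdot> J'"
    using assms by induct (auto intro: ideal_prod.intros)
qed

lemma ideal_prod_left_commute:
  assumes "ideal I R" "ideal J R" "ideal K R"
  shows "I \<cdot> (J \<cdot> K) = J \<cdot> (I \<cdot> K)"
  using assms ideal_prod_assoc[of I J K] ideal_prod_assoc[of J I K] ideal_prod_commute[of I J]
  by simp

lemma ideal_prod_subset_left: "ideal I R \<Longrightarrow> ideal J R \<Longrightarrow> I \<cdot> J \<subseteq> I"
  and ideal_prod_subset_right: "ideal I R \<Longrightarrow> ideal J R \<Longrightarrow> I \<cdot> J \<subseteq> J"
  using ideal_prod_inter by blast+

lemma ideal_prod_one_left: "ideal I R \<Longrightarrow> carrier R \<cdot> I = I"
  using ideal_prod_commute[OF oneideal] ideal_prod_one by simp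

lemma mem_set_add_iff: "x \<in> I <+> J \<longleftrightarrow> (\<exists>i\<in>I. \<exists>j\<in>J. x = i \<oplus> j)"
  by (auto simp: set_add_def')

lemma subset_set_add_left:
  assumes "ideal I R" "ideal J R" shows "I \<subseteq> I <+> J"
proof
  fix x assume "x \<in> I"
  then have "x = x \<oplus> \<zero>" using ideal.Icarr[OF assms(1)] by simp
  then show "x \<in> I <+> J"
    using \<open>x \<in> I\<close> additive_subgroup.zero_closed[OF ideal.axioms(1)[OF assms(2)]]
    unfolding mem_set_add_iff by blast
qed

lemma subset_set_add_right:
  assumes "ideal I R" "ideal J R" shows "J \<subseteq> I <+> J"
  using subset_set_add_left[OF assms(2,1)] set_add_comm[of I J]
    ideal.Icarr[OF assms(1)] ideal.Icarr[OF assms(2)] by blast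

lemma set_add_subset_ideal:
  assumes "ideal K R" "I \<subseteq> K" "J \<subseteq> K" shows "I <+> J \<subseteq> K"
  using assms additive_subgroup.a_closed[OF ideal.axioms(1)[OF assms(1)]]
  unfolding mem_set_add_iff subset_iff by blast

lemma mem_cgenideal_iff: "x \<in> PIdl a \<longleftrightarrow> (\<exists>r\<in>carrier R. x = r \<otimes> a)"
  by (auto simp: cgenideal_def)

lemma mem_add_cgenideal_iff:
  "x \<in> I <+> PIdl a \<longleftrightarrow> (\<exists>i\<in>I. \<exists>r\<in>carrier R. x = i \<oplus> r \<otimes> a)"
proof -
  have "x \<in> I <+> PIdl a \<longleftrightarrow> (\<exists>i\<in>I. \<exists>j. j \<in> PIdl a \<and> x = i \<oplus> j)"
    unfolding mem_set_add_iff by (simp add: Bex_def)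
  then show ?thesis unfolding mem_cgenideal_iff by blast
qed

lemma mem_cgenideal_prodE:
  assumes "a \<in> carrier R" "ideal J R" "x \<in> (PIdl a) \<cdot> J"
  obtains j where "j \<in> J" "x = a \<otimes> j"
proof -
  from assms(3) have "\<exists>j\<in>J. x = a \<otimes> j"
  proof induct
    case (prod i j)
    then obtain r where r: "r \<in> carrier R" "i = r \<otimes> a" by (auto simp: mem_cgenideal_iff)
    have j: "j \<in> carrier R" using prod ideal.Icarr[OF assms(2)] by simp
    have "i \<otimes> j = a \<otimes> (r \<otimes> j)" using r j assms(1) by (simp add: m_ac)
    moreover have "r \<otimes> j \<in> J" using prod r ideal.I_l_closed[OF assms(2)] by simp
    ultimately show ?case by blast
  next
    case (sum s1 s2)
    then obtain j1 j2 where j: "j1 \<in> J" "j2 \<in> J" "s1 = a \<otimes> j1" "s2 = a \<otimes> j2" by blast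
    then have "s1 \<oplus> s2 = a \<otimes> (j1 \<oplus> j2)"
      using assms(1) ideal.Icarr[OF assms(2)] by (simp add: r_distr)
    moreover have "j1 \<oplus> j2 \<in> J"
      using j additive_subgroup.a_closed[OF ideal.axioms(1)[OF assms(2)]] by simp
    ultimately show ?case by blast
  qed
  then show thesis using that by blast
qed

lemma ideal_prod_list_Nil [simp]: "ideal_prod_list R [] = carrier R"
  and ideal_prod_list_Cons [simp]: "ideal_prod_list R (I # Is) = I \<cdot> ideal_prod_list R Is"
  by (simp_all add: ideal_prod_list_def)

lemma ideal_prod_list_ideal:
  "(\<And>I. I \<in> set Is \<Longrightarrow> ideal I R) \<Longrightarrow> ideal (ideal_prod_list R Is) R"
  by (induct Is) (auto intro: ideal_prod_is_ideal oneideal)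

lemma ideal_prod_list_append:
  assumes "\<And>I. I \<in> set Is \<Longrightarrow> ideal I R" "\<And>I. I \<in> set Js \<Longrightarrow> ideal I R"
  shows "ideal_prod_list R (Is @ Js) = ideal_prod_list R Is \<cdot> ideal_prod_list R Js"
  using assms
  by (induct Is) (auto simp: ideal_prod_one_left ideal_prod_list_ideal ideal_prod_assoc)

lemma ideal_prod_list_subset_member:
  assumes "\<And>I. I \<in> set Is \<Longrightarrow> ideal I R" "J \<in> set Is"
  shows "ideal_prod_list R Is \<subseteq> J"
  using assms
proof (induct Is)
  case (Cons I Is)
  then have *: "ideal I R" "ideal (ideal_prod_list R Is) R" by (auto intro: ideal_prod_list_ideal)
  show ?case
    using Cons ideal_prod_subset_left[OF *] ideal_prod_subset_right[OF *] by fastforce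
qed simp

lemma ideal_prod_list_remove1:
  assumes "\<And>I. I \<in> set Is \<Longrightarrow> ideal I R" "J \<in> set Is"
  shows "ideal_prod_list R Is = J \<cdot> ideal_prod_list R (remove1 J Is)"
  using assms
proof (induct Is)
  case (Cons I Is)
  show ?case
  proof (cases "I = J")
    case False
    then have "ideal_prod_list R Is = J \<cdot> ideal_prod_list R (remove1 J Is)"
      using Cons by auto
    moreover have "ideal (ideal_prod_list R (remove1 J Is)) R"
      using Cons.prems(1) by (auto intro!: ideal_prod_list_ideal dest: notin_set_remove1)
    moreover have "ideal I R" "ideal J R" using Cons.prems by auto
    ultimately show ?thesis using False by (simp add: ideal_prod_left_commute)
  qed simp
qed simp

lemma prime_contains_factor:
  assumes "primeideal P R" "\<And>I. I \<in> set Is \<Longrightarrow> ideal I R" "ideal_prod_list R Is \<subseteq> P"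
  shows "\<exists>I\<in>set Is. I \<subseteq> P"
  using assms(2,3)
proof (induct Is)
  case Nil
  then show ?case
    using primeideal.I_notcarr[OF assms(1)] ideal.Icarr[OF primeideal.axioms(1)[OF assms(1)]] by auto
next
  case (Cons I Is)
  then have "I \<subseteq> P \<or> ideal_prod_list R Is \<subseteq> P"
    using primeideal_divides_ideal_prod[of P I "ideal_prod_list R Is"] assms(1)
    by (simp add: ideal_prod_list_ideal)
  then show ?case using Cons by auto
qed

lemma primeideal_cancel:
  assumes "primeideal P R" "a \<in> carrier R" "b \<in> carrier R" "a \<otimes> b \<in> P" "a \<notin> P"
  shows "b \<in> P"
  using primeideal.I_prime[OF assms(1-4)] assms(5) by blast

text \<open>Zorn's lemma, applied to the ideals that contain \<open>I\<close> but not 1.\<close>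

lemma exists_maximalideal_containing:
  assumes "ideal I R" "\<one> \<notin> I"
  shows "\<exists>M. maximalideal M R \<and> I \<subseteq> M"
proof -
  let ?A = "{J. ideal J R \<and> I \<subseteq> J \<and> \<one> \<notin> J}"
  have "\<exists>U\<in>?A. \<forall>X\<in>C. X \<subseteq> U" if C: "subset.chain ?A C" for C
  proof (cases "C = {}")
    case True
    then show ?thesis using assms by auto
  next
    case False
    have CA: "\<And>X. X \<in> C \<Longrightarrow> ideal X R" "\<And>X. X \<in> C \<Longrightarrow> I \<subseteq> X \<and> \<one> \<notin> X"
      and tot: "\<And>X Y. X \<in> C \<Longrightarrow> Y \<in> C \<Longrightarrow> X \<subseteq> Y \<or> Y \<subseteq> X"
      using C unfolding subset.chain_def by auto
    have "ideal (\<Union>C) R"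
    proof (rule idealI)
      show "ring R" ..
      show "subgroup (\<Union>C) (add_monoid R)"
      proof
        show "\<Union>C \<subseteq> carrier (add_monoid R)" using ideal.Icarr[OF CA(1)] by auto
        show "\<one>\<^bsub>add_monoid R\<^esub> \<in> \<Union>C"
          using False additive_subgroup.zero_closed[OF ideal.axioms(1)[OF CA(1)]] by auto
        fix x assume x: "x \<in> \<Union>C"
        then obtain X where X: "X \<in> C" "x \<in> X" by blast
        have "inv\<^bsub>add_monoid R\<^esub> x \<in> X"
          using additive_subgroup.a_inv_closed[OF ideal.axioms(1)[OF CA(1)[OF X(1)]] X(2)]
          unfolding a_inv_def .
        then show "inv\<^bsub>add_monoid R\<^esub> x \<in> \<Union>C" using X by blast
        fix y assume "y \<in> \<Union>C"
        then obtain Y where Y: "Y \<in> C" "y \<in> Y" by blast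
        obtain Z where "Z \<in> C" "x \<in> Z" "y \<in> Z" using tot[OF X(1) Y(1)] X Y by blast
        then have "x \<oplus> y \<in> Z" using additive_subgroup.a_closed[OF ideal.axioms(1)[OF CA(1)]] by blast
        then show "x \<otimes>\<^bsub>add_monoid R\<^esub> y \<in> \<Union>C" using \<open>Z \<in> C\<close> by auto
      qed
    next
      fix a x assume "a \<in> \<Union>C" "x \<in> carrier R"
      then show "x \<otimes> a \<in> \<Union>C" "a \<otimes> x \<in> \<Union>C"
        using CA by (auto dest: ideal.I_l_closed ideal.I_r_closed)
    qed
    then show ?thesis using False CA by blast
  qed
  from subset_Zorn[OF this] obtain M
    where M: "M \<in> ?A" "\<forall>X\<in>?A. M \<subseteq> X \<longrightarrow> X = M" by blast
  have "maximalideal M R"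
  proof (rule maximalidealI)
    show "ideal M R" using M by blast
    show "carrier R \<noteq> M" using M by auto
    fix J assume J: "ideal J R" "M \<subseteq> J" "J \<subseteq> carrier R"
    show "J = M \<or> J = carrier R"
    proof (cases "\<one> \<in> J")
      case True
      then show ?thesis using ideal.one_imp_carrier[OF J(1)] by blast
    next
      case False
      then show ?thesis using J M by blast
    qed
  qed
  then show ?thesis using M by blast
qed

lemma maximalideal_comaximal:
  assumes M: "maximalideal M R" and J: "ideal J R" "\<not> J \<subseteq> M"
  obtains m j where "m \<in> M" "j \<in> J" "m \<oplus> j = \<one>"
proof -
  have M': "ideal M R" using M maximalideal.axioms(1) by blast
  have "M <+> J = M \<or> M <+> J = carrier R"
    using maximalideal.I_maximal[OF M add_ideals[OF M' J(1)]] subset_set_add_left[OF M' J(1)]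
      ideal.Icarr[OF add_ideals[OF M' J(1)]] by blast
  then have "\<one> \<in> M <+> J" using subset_set_add_right[OF M' J(1)] J(2) by auto
  then show thesis using that unfolding mem_set_add_iff by auto
qed

lemma maximalideal_one_decomp:
  assumes M: "maximalideal M R" and b: "b \<in> carrier R" "b \<notin> M"
  obtains m c where "m \<in> M" "c \<in> carrier R" "m \<oplus> c \<otimes> b = \<one>"
proof -
  have "\<not> PIdl b \<subseteq> M" using cgenideal_self[OF b(1)] b by blast
  from maximalideal_comaximal[OF M cgenideal_ideal[OF b(1)] this] obtain m j
    where "m \<in> M" "j \<in> PIdl b" "m \<oplus> j = \<one>" by blast
  then show thesis using that unfolding mem_cgenideal_iff by blast
qed

end

section \<open>Prime factorizations of ideals\<close>

definition prime_product :: "('a, 'm) ring_scheme \<Rightarrow> 'a set \<Rightarrow> bool" where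
  "prime_product R I \<longleftrightarrow> (\<exists>Ps. (\<forall>P\<in>set Ps. primeideal P R) \<and> I = ideal_prod_list R Ps)"

lemma (in cring) general_ZPI_ring_iff:
  "general_ZPI_ring R \<longleftrightarrow> \<one> \<noteq> \<zero> \<and> (\<forall>I. ideal I R \<longrightarrow> prime_product R I)"
proof -
  have "prime_product R (carrier R)"
    unfolding prime_product_def by (rule exI[of _ "[]"]) simp
  then show ?thesis
    unfolding general_ZPI_ring_def proper_ideal_def prime_product_def
    using is_cring by blast
qed

context cring
begin

lemma ideal_if_prime: "primeideal P R \<Longrightarrow> ideal P R"
  by (rule primeideal.axioms(1))

lemma prime_product_mult:
  assumes "prime_product R I" "prime_product R J"
  shows "prime_product R (I \<cdot> J)"
proof -
  obtain Ps Qs where "\<forall>P\<in>set Ps. primeideal P R" "I = ideal_prod_list R Ps"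
      "\<forall>P\<in>set Qs. primeideal P R" "J = ideal_prod_list R Qs"
    using assms unfolding prime_product_def by blast
  then show ?thesis
    unfolding prime_product_def
    by (intro exI[of _ "Ps @ Qs"]) (auto simp: ideal_prod_list_append ideal_if_prime)
qed

lemma prime_product_prime:
  assumes "primeideal P R" shows "prime_product R P"
  unfolding prime_product_def using assms
  by (intro exI[of _ "[P]"]) (simp add: ideal_prod_one ideal_if_prime)

text \<open>The next two lemmas describe prime factorizations in the domain \<open>R/Q\<close>, in terms of ideals
  of \<open>R\<close>, so that no ideals of the quotient ring have to be pulled back. Cancellation: if \<open>W\<close> equals
  a principal ideal modulo \<open>Q\<close>, then cancelling \<open>W\<close> means cancelling the generator \<open>c\<close>, which is
  not a zero divisor modulo \<open>Q\<close>.\<close>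

lemma cancel_mod_prime:
  assumes Q: "primeideal Q R" and c: "c \<in> carrier R" "c \<notin> Q"
    and W: "ideal W R" "W \<subseteq> PIdl c <+> Q" "c \<in> W <+> Q"
    and X: "ideal X R" and X': "ideal X' R" and le: "W \<cdot> X \<subseteq> W \<cdot> X' <+> Q"
  shows "X \<subseteq> X' <+> Q"
proof
  fix x assume x: "x \<in> X"
  note Q' = ideal_if_prime[OF Q]
  note Qc = ideal.Icarr[OF Q'] and Xc = ideal.Icarr[OF X] and X'c = ideal.Icarr[OF X']
    and Wc = ideal.Icarr[OF W(1)]
  have xc: "x \<in> carrier R" using x Xc by blast
  obtain w q where wq: "w \<in> W" "q \<in> Q" "c = w \<oplus> q" using W(3) by (auto simp: mem_set_add_iff)
  have "w \<otimes> x \<in> W \<cdot> X" using wq x by (auto intro: ideal_prod.prod)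
  then obtain v q1 where v: "v \<in> W \<cdot> X'" "q1 \<in> Q" "w \<otimes> x = v \<oplus> q1"
    using subsetD[OF le] unfolding mem_set_add_iff by blast
  have sub: "W \<cdot> X' \<subseteq> (PIdl c) \<cdot> X' <+> Q"
  proof (rule ideal_prod_subset)
    show id: "ideal ((PIdl c) \<cdot> X' <+> Q) R"
      by (intro add_ideals ideal_prod_is_ideal cgenideal_ideal Q' X' c)
    fix i j assume ij: "i \<in> W" "j \<in> X'"
    then obtain p r where pr: "p \<in> PIdl c" "r \<in> Q" "i = p \<oplus> r"
      using subsetD[OF W(2)] unfolding mem_set_add_iff by blast
    have pc: "p \<in> carrier R" using pr(1) ideal.Icarr[OF cgenideal_ideal[OF c(1)]] by blast
    have "i \<otimes> j = p \<otimes> j \<oplus> r \<otimes> j"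
      using pr pc ij Qc X'c by (simp add: l_distr)
    moreover have "p \<otimes> j \<in> (PIdl c) \<cdot> X'" using pr ij by (auto intro: ideal_prod.prod)
    moreover have "r \<otimes> j \<in> Q" using pr ij X'c ideal.I_r_closed[OF Q'] by blast
    ultimately show "i \<otimes> j \<in> (PIdl c) \<cdot> X' <+> Q" unfolding mem_set_add_iff by blast
  qed
  obtain u q2 where u: "u \<in> (PIdl c) \<cdot> X'" "q2 \<in> Q" "v = u \<oplus> q2"
    using subsetD[OF sub v(1)] unfolding mem_set_add_iff by blast
  obtain y where y: "y \<in> X'" "u = c \<otimes> y"
    using mem_cgenideal_prodE[OF c(1) X' u(1)] by blast
  have carr: "w \<in> carrier R" "q \<in> carrier R" "q1 \<in> carrier R" "q2 \<in> carrier R" "y \<in> carrier R"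
    using wq v u y Qc X'c Wc by auto
  have eq: "c \<otimes> x = c \<otimes> y \<oplus> (q2 \<oplus> q1 \<oplus> q \<otimes> x)"
    using wq(3) v(3) u(3) y(2) carr xc by (simp add: l_distr a_assoc)
  have q3: "q2 \<oplus> q1 \<oplus> q \<otimes> x \<in> Q" (is "?q \<in> Q")
    using u(2) v(2) ideal.I_r_closed[OF Q' wq(2) xc]
    by (intro additive_subgroup.a_closed[OF ideal.axioms(1)[OF Q']])
  have "c \<otimes> (x \<ominus> y) = c \<otimes> x \<ominus> c \<otimes> y"
    using c(1) xc carr by (simp add: minus_eq r_distr r_minus)
  also have "\<dots> = ?q" using eq Qc[OF q3] c(1) carr
    by (simp add: minus_eq a_ac r_neg r_neg1 r_neg2)
  finally have "c \<otimes> (x \<ominus> y) \<in> Q" using q3 by simp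
  then have "x \<ominus> y \<in> Q"
    using primeideal_cancel[OF Q c(1) _ _ c(2)] xc carr by simp
  moreover have "x = y \<oplus> (x \<ominus> y)"
    using xc carr by (simp add: minus_eq a_ac r_neg r_neg1 r_neg2)
  ultimately show "x \<in> X' <+> Q" using y unfolding mem_set_add_iff by blast
qed

text \<open>Uniqueness of prime factorizations modulo \<open>Q\<close>, for divisors of a nonzero principal ideal.
  The cofactor \<open>Y\<close> is there for the induction: once a prime has been cancelled, the remaining product
  still divides the same principal ideal. As all the factors contain \<open>Q\<close>, they correspond to primes of
  \<open>R/Q\<close>, and the two lists have the same product in \<open>R\<close> itself, not only modulo \<open>Q\<close>.\<close>

lemma prime_products_congruent_imp_eq:
  assumes Q: "primeideal Q R" and c: "c \<in> carrier R" "c \<notin> Q"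
  shows "\<lbrakk> \<forall>P\<in>set Ps. primeideal P R \<and> Q \<subseteq> P; \<forall>P\<in>set Ps'. primeideal P R \<and> Q \<subseteq> P;
      ideal_prod_list R Ps \<subseteq> ideal_prod_list R Ps' <+> Q;
      ideal_prod_list R Ps' \<subseteq> ideal_prod_list R Ps <+> Q;
      ideal Y R; Y \<cdot> ideal_prod_list R Ps \<subseteq> PIdl c <+> Q;
      c \<in> Y \<cdot> ideal_prod_list R Ps <+> Q \<rbrakk>
    \<Longrightarrow> ideal_prod_list R Ps = ideal_prod_list R Ps'"
proof (induct "length Ps" arbitrary: Ps Ps' Y)
  case 0
  then have Ps: "Ps = []" by simp
  show ?case
  proof (cases "Ps' = []")
    case False
    then obtain P' where P': "P' \<in> set Ps'" by fastforce
    have "ideal_prod_list R Ps' \<subseteq> P'"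
      using 0(3) P' by (intro ideal_prod_list_subset_member) (auto intro: ideal_if_prime)
    then have "carrier R \<subseteq> P'"
      using 0(4) Ps 0(3) P' set_add_subset_ideal[of P' "ideal_prod_list R Ps'" Q] ideal_if_prime
      by auto
    moreover have "primeideal P' R" using 0(3) P' by blast
    ultimately show ?thesis
      using primeideal.I_notcarr ideal.Icarr[OF ideal_if_prime] by blast
  qed (simp add: Ps)
next
  case (Suc n)
  note Q' = ideal_if_prime[OF Q]
  have Pid: "\<And>P. P \<in> set Ps \<Longrightarrow> ideal P R" and Pid': "\<And>P. P \<in> set Ps' \<Longrightarrow> ideal P R"
    using Suc.prems(1,2) ideal_if_prime by blast+
  have "set Ps \<noteq> {}" using Suc.hyps(2) by auto
  \<comment> \<open>A minimal factor occurs on both sides, because each side, together with \<open>Q\<close>, lies below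
    each factor of the other.\<close>
  then obtain P where P: "P \<in> set Ps" "\<forall>P2\<in>set Ps. P2 \<subseteq> P \<longrightarrow> P2 = P"
    using finite_has_minimal[of "set Ps"] by auto
  have "ideal_prod_list R Ps' \<subseteq> P"
    using Suc.prems(4) set_add_subset_ideal[OF Pid[OF P(1)] ideal_prod_list_subset_member[OF Pid P(1)]]
      Suc.prems(1) P(1) by blast
  then obtain P' where P': "P' \<in> set Ps'" "P' \<subseteq> P"
    using prime_contains_factor[of P Ps'] Suc.prems(1) P(1) Pid' by blast
  have "ideal_prod_list R Ps \<subseteq> P'"
    using Suc.prems(3) set_add_subset_ideal[OF Pid'[OF P'(1)] ideal_prod_list_subset_member[OF Pid' P'(1)]]
      Suc.prems(2) P'(1) by blast
  then obtain P2 where "P2 \<in> set Ps" "P2 \<subseteq> P'"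
    using prime_contains_factor[of P' Ps] Suc.prems(2) P'(1) Pid by blast
  then have "P' = P" using P P' by blast
  then have PPs': "P \<in> set Ps'" using P' by simp
  define X where "X = ideal_prod_list R (remove1 P Ps)"
  define X' where "X' = ideal_prod_list R (remove1 P Ps')"
  have XX: "ideal X R" "ideal X' R" "ideal P R" "ideal Y R"
    using Pid Pid' P(1) Suc.prems(5) unfolding X_def X'_def
    by (auto intro!: ideal_prod_list_ideal dest: notin_set_remove1)
  have eqs: "ideal_prod_list R Ps = P \<cdot> X" "ideal_prod_list R Ps' = P \<cdot> X'"
    unfolding X_def X'_def using Pid Pid' P(1) PPs' by (auto intro!: ideal_prod_list_remove1)
  define W where "W = Y \<cdot> (P \<cdot> X)"
  have W: "ideal W R" "W \<subseteq> PIdl c <+> Q" "c \<in> W <+> Q"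
    using Suc.prems(6,7) XX unfolding W_def eqs by (auto intro: ideal_prod_is_ideal)
  have key: "W \<cdot> U \<subseteq> W \<cdot> V <+> Q"
    if U: "ideal U R" and V: "ideal V R" and le: "P \<cdot> U \<subseteq> P \<cdot> V <+> Q" for U V
  proof -
    have WU: "W \<cdot> U = (Y \<cdot> X) \<cdot> (P \<cdot> U)" "W \<cdot> V = (Y \<cdot> X) \<cdot> (P \<cdot> V)"
      unfolding W_def using XX U V
      by (simp_all add: ideal_prod_assoc ideal_prod_is_ideal ideal_prod_left_commute)
    have "W \<cdot> U \<subseteq> (Y \<cdot> X) \<cdot> (P \<cdot> V <+> Q)"
      unfolding WU using le by (rule ideal_prod_mono[OF subset_refl])
    also have "\<dots> = (Y \<cdot> X) \<cdot> (P \<cdot> V) <+> (Y \<cdot> X) \<cdot> Q"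
      using XX V Q' by (intro ideal_prod_distr) (auto intro: ideal_prod_is_ideal)
    also have "\<dots> \<subseteq> W \<cdot> V <+> Q"
      unfolding WU using ideal_prod_subset_right[of "Y \<cdot> X" Q] XX Q'
      by (simp add: ideal_prod_is_ideal) (unfold mem_set_add_iff subset_iff, blast)
    finally show ?thesis .
  qed
  have "X \<subseteq> X' <+> Q"
    by (rule cancel_mod_prime[OF Q c W _ _ key])
      (use XX Suc.prems(3) in \<open>simp_all only: eqs\<close>)
  moreover have "X' \<subseteq> X <+> Q"
    by (rule cancel_mod_prime[OF Q c W _ _ key])
      (use XX Suc.prems(4) in \<open>simp_all only: eqs\<close>)
  moreover have "W = (Y \<cdot> P) \<cdot> X" using XX by (simp add: W_def ideal_prod_assoc)
  moreover have "n = length (remove1 P Ps)" using Suc.hyps(2) P(1) by (simp add: length_remove1)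
  moreover have "\<forall>P2\<in>set (remove1 P Ps). primeideal P2 R \<and> Q \<subseteq> P2"
      "\<forall>P2\<in>set (remove1 P Ps'). primeideal P2 R \<and> Q \<subseteq> P2"
    using Suc.prems(1,2) by (auto dest: notin_set_remove1)
  ultimately have "X = X'"
    using Suc.hyps(1)[of "remove1 P Ps" "remove1 P Ps'" "Y \<cdot> P"] W XX
    by (auto simp: X_def[symmetric] X'_def[symmetric] ideal_prod_is_ideal)
  then show ?case unfolding eqs by simp
qed

end

section \<open>Primes in general ZPI-rings\<close>

context cring
begin

lemma ZPI_prime_product:
  assumes "general_ZPI_ring R" "ideal I R"
  obtains Ps where "\<And>P. P \<in> set Ps \<Longrightarrow> primeideal P R" "I = ideal_prod_list R Ps"
  using assms unfolding general_ZPI_ring_iff prime_product_def by blast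

text \<open>With \<open>B = Q + (a)\<close>, uniqueness of factorizations modulo \<open>Q\<close> gives \<open>B\<^sup>2 = Q + (a\<^sup>2)\<close>. So an
  element \<open>q\<close> of \<open>Q\<close> lies in \<open>B\<^sup>2 = QB + aB\<close>. Its part in \<open>aB\<close> is \<open>ad\<close> with \<open>ad\<close> in \<open>Q\<close>, hence
  \<open>d\<close> in \<open>Q\<close>, and \<open>ad\<close> lies in \<open>QB\<close> too.\<close>

lemma ZPI_prime_absorbs_sum:
  assumes zpi: "general_ZPI_ring R" and Q: "primeideal Q R" and a: "a \<in> carrier R" "a \<notin> Q"
  shows "Q \<cdot> (Q <+> PIdl a) = Q"
proof
  note Q' = ideal_if_prime[OF Q]
  let ?B = "Q <+> PIdl a" and ?B2 = "Q <+> PIdl (a \<otimes> a)"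
  have id: "ideal (PIdl a) R" "ideal (PIdl (a \<otimes> a)) R" "ideal ?B R" "ideal ?B2 R"
    using a(1) by (auto intro!: add_ideals Q' cgenideal_ideal)
  show "Q \<cdot> ?B \<subseteq> Q" by (rule ideal_prod_subset_left[OF Q' id(3)])
  obtain Ps where Ps: "\<And>P. P \<in> set Ps \<Longrightarrow> primeideal P R" "?B = ideal_prod_list R Ps"
    using ZPI_prime_product[OF zpi id(3)] by blast
  obtain Ps' where Ps': "\<And>P. P \<in> set Ps' \<Longrightarrow> primeideal P R" "?B2 = ideal_prod_list R Ps'"
    using ZPI_prime_product[OF zpi id(4)] by blast
  have QP: "Q \<subseteq> P" if "P \<in> set Ps" for P
    using subset_set_add_left[OF Q' id(1)] ideal_prod_list_subset_member[of Ps P] Ps that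
      ideal_if_prime by blast
  have QP': "Q \<subseteq> P" if "P \<in> set Ps'" for P
    using subset_set_add_left[OF Q' id(2)] ideal_prod_list_subset_member[of Ps' P] Ps' that
      ideal_if_prime by blast
  have BB: "ideal_prod_list R (Ps @ Ps) = ?B \<cdot> ?B"
    using Ps by (subst ideal_prod_list_append) (auto intro: ideal_if_prime)
  have aac: "a \<otimes> a \<in> carrier R" using a(1) by simp
  have aaQ: "a \<otimes> a \<notin> Q"
  proof
    assume "a \<otimes> a \<in> Q"
    from primeideal_cancel[OF Q a(1) a(1) this a(2)] show False using a(2) by simp
  qed
  note Qc = ideal.Icarr[OF Q']
  have BB_mem: "i \<otimes> j \<in> ?B2" if ij: "i \<in> ?B" "j \<in> ?B" for i j
  proof -
    obtain q r where qr: "q \<in> Q" "r \<in> carrier R" "i = q \<oplus> r \<otimes> a"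
      using ij(1) unfolding mem_add_cgenideal_iff by blast
    obtain p s where ps: "p \<in> Q" "s \<in> carrier R" "j = p \<oplus> s \<otimes> a"
      using ij(2) unfolding mem_add_cgenideal_iff by blast
    have jc: "j \<in> carrier R" using ps Qc a(1) by simp
    have "q \<in> carrier R" "p \<in> carrier R" using qr ps Qc by auto
    then have "i \<otimes> j = (q \<otimes> j \<oplus> (r \<otimes> a) \<otimes> p) \<oplus> (r \<otimes> s) \<otimes> (a \<otimes> a)"
      unfolding qr(3) ps(3) using qr(2) ps(2) a(1) by (simp add: l_distr r_distr m_ac a_ac)
    moreover have "q \<otimes> j \<oplus> (r \<otimes> a) \<otimes> p \<in> Q"
      using ideal.I_r_closed[OF Q' qr(1) jc] ideal.I_l_closed[OF Q' ps(1)] qr(2) a(1)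
      by (intro additive_subgroup.a_closed[OF ideal.axioms(1)[OF Q']]) auto
    moreover have "r \<otimes> s \<in> carrier R" using qr ps by simp
    ultimately show ?thesis unfolding mem_add_cgenideal_iff by blast
  qed
  have le: "?B \<cdot> ?B \<subseteq> ?B2" by (rule ideal_prod_subset[OF id(4) BB_mem])
  have aB: "a \<in> ?B" using subset_set_add_right[OF Q' id(1)] cgenideal_self[OF a(1)] by blast
  then have aaBB: "a \<otimes> a \<in> ?B \<cdot> ?B" by (intro ideal_prod.prod)
  have idBB: "ideal (?B \<cdot> ?B) R" using id by (intro ideal_prod_is_ideal)
  have ge: "?B2 \<subseteq> ?B \<cdot> ?B <+> Q"
    by (rule set_add_subset_ideal[OF add_ideals[OF idBB Q'] subset_set_add_right[OF idBB Q']
          subset_trans[OF cgenideal_minimal[OF idBB aaBB] subset_set_add_left[OF idBB Q']]])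
  \<comment> \<open>The cofactor is the unit ideal: both sides are equal to \<open>(a\<^sup>2)\<close> modulo \<open>Q\<close>.\<close>
  have "ideal_prod_list R (Ps @ Ps) = ideal_prod_list R Ps'"
  proof (rule prime_products_congruent_imp_eq[OF Q aac aaQ])
    show "\<forall>P\<in>set (Ps @ Ps). primeideal P R \<and> Q \<subseteq> P" "\<forall>P\<in>set Ps'. primeideal P R \<and> Q \<subseteq> P"
      using Ps Ps' QP QP' by auto
    show "ideal_prod_list R (Ps @ Ps) \<subseteq> ideal_prod_list R Ps' <+> Q"
      unfolding BB Ps'(2)[symmetric] using le subset_set_add_left[OF id(4) Q'] by blast
    show "ideal_prod_list R Ps' \<subseteq> ideal_prod_list R (Ps @ Ps) <+> Q"
      unfolding BB Ps'(2)[symmetric] by (rule ge)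
    show "ideal (carrier R) R" by (rule oneideal)
    have "?B2 = PIdl (a \<otimes> a) <+> Q"
      by (intro set_add_comm subsetI) (auto intro: Qc ideal.Icarr[OF id(2)])
    then show "carrier R \<cdot> ideal_prod_list R (Ps @ Ps) \<subseteq> PIdl (a \<otimes> a) <+> Q"
      unfolding BB ideal_prod_one_left[OF idBB] using le by simp
    show "a \<otimes> a \<in> carrier R \<cdot> ideal_prod_list R (Ps @ Ps) <+> Q"
      unfolding BB ideal_prod_one_left[OF idBB]
      using aaBB subset_set_add_left[OF idBB Q'] by blast
  qed
  then have eq: "?B \<cdot> ?B = ?B2" unfolding BB Ps'(2) .
  show "Q \<subseteq> Q \<cdot> ?B"
  proof
    fix q assume q: "q \<in> Q"
    then have "q \<in> ?B \<cdot> ?B" using eq subset_set_add_left[OF Q' id(2)] by blast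
    also have "?B \<cdot> ?B = ?B \<cdot> Q <+> ?B \<cdot> (PIdl a)"
      using id Q' by (intro ideal_prod_distr)
    also have "\<dots> = Q \<cdot> ?B <+> (PIdl a) \<cdot> ?B"
      using id Q' by (simp add: ideal_prod_commute)
    finally obtain y z where yz: "y \<in> Q \<cdot> ?B" "z \<in> (PIdl a) \<cdot> ?B" "q = y \<oplus> z"
      unfolding mem_set_add_iff by blast
    obtain d where d: "d \<in> ?B" "z = a \<otimes> d" using mem_cgenideal_prodE[OF a(1) id(3) yz(2)] by blast
    have dc: "d \<in> carrier R" using ideal.Icarr[OF id(3) d(1)] .
    have yQ: "y \<in> Q" using yz ideal_prod_subset_left[OF Q' id(3)] by blast
    then have "a \<otimes> d = q \<ominus> y"
      using yz(3) d(2) Qc a(1) dc by (simp add: minus_eq a_ac r_neg r_neg1 r_neg2)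
    moreover have "q \<ominus> y \<in> Q"
      unfolding minus_eq using q additive_subgroup.a_inv_closed[OF ideal.axioms(1)[OF Q'] yQ]
      by (intro additive_subgroup.a_closed[OF ideal.axioms(1)[OF Q']])
    ultimately have "d \<in> Q" using primeideal_cancel[OF Q a(1) dc _ a(2)] by simp
    then have "d \<otimes> a \<in> Q \<cdot> ?B" using aB by (intro ideal_prod.prod)
    then have "z \<in> Q \<cdot> ?B" using d(2) m_comm[OF a(1) dc] by simp
    then show "q \<in> Q \<cdot> ?B" unfolding yz(3) using yz(1) by (intro ideal_prod.sum)
  qed
qed

lemma ZPI_prime_absorbs_larger_ideal:
  assumes zpi: "general_ZPI_ring R" and Q: "primeideal Q R" and M: "ideal M R" "Q \<subset> M"
  shows "Q \<cdot> M = Q"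
proof
  note Q' = ideal_if_prime[OF Q]
  show "Q \<cdot> M \<subseteq> Q" by (rule ideal_prod_subset_left[OF Q' M(1)])
  obtain a where a: "a \<in> M" "a \<notin> Q" using M(2) by blast
  have ac: "a \<in> carrier R" using ideal.Icarr[OF M(1) a(1)] .
  have "Q <+> PIdl a \<subseteq> M"
    using M a cgenideal_minimal[OF M(1) a(1)] by (intro set_add_subset_ideal) auto
  then have "Q \<cdot> (Q <+> PIdl a) \<subseteq> Q \<cdot> M" by (intro ideal_prod_mono) auto
  then show "Q \<subseteq> Q \<cdot> M" unfolding ZPI_prime_absorbs_sum[OF zpi Q ac a(2)] .
qed

text \<open>Some prime factor \<open>P\<close> of the principal ideal of \<open>x\<close> lies in \<open>Q\<close>. Multiplication by \<open>M\<close> leaves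
  \<open>P\<close> unchanged, hence also the ideal of \<open>x\<close>.\<close>

lemma ZPI_element_fixed:
  assumes zpi: "general_ZPI_ring R" and Q: "primeideal Q R" and M: "ideal M R"
    and abs: "\<And>P. primeideal P R \<Longrightarrow> P \<subseteq> Q \<Longrightarrow> P \<cdot> M = P"
    and x: "x \<in> Q"
  shows "\<exists>m\<in>M. x = x \<otimes> m"
proof -
  note Q' = ideal_if_prime[OF Q]
  have xc: "x \<in> carrier R" using ideal.Icarr[OF Q' x] .
  have idx: "ideal (PIdl x) R" using cgenideal_ideal[OF xc] .
  obtain Ps where Ps: "\<And>P. P \<in> set Ps \<Longrightarrow> primeideal P R" "PIdl x = ideal_prod_list R Ps"
    using ZPI_prime_product[OF zpi idx] by blast
  have "ideal_prod_list R Ps \<subseteq> Q" using cgenideal_minimal[OF Q' x] Ps(2) by simp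
  then obtain P where P: "P \<in> set Ps" "P \<subseteq> Q"
    using prime_contains_factor[OF Q, of Ps] Ps(1) ideal_if_prime by blast
  define C where "C = ideal_prod_list R (remove1 P Ps)"
  have PC: "PIdl x = P \<cdot> C" unfolding C_def Ps(2)
    using Ps(1) P(1) ideal_if_prime by (intro ideal_prod_list_remove1) auto
  have id: "ideal P R" "ideal C R"
    using Ps(1) P(1) ideal_if_prime unfolding C_def
    by (auto intro!: ideal_prod_list_ideal dest: notin_set_remove1)
  have "(PIdl x) \<cdot> M = (P \<cdot> M) \<cdot> C"
    unfolding PC using id M by (simp add: ideal_prod_assoc ideal_prod_commute[of C M])
  also have "\<dots> = PIdl x" using abs[OF Ps(1)[OF P(1)] P(2)] PC by simp
  finally have "x \<in> (PIdl x) \<cdot> M" using cgenideal_self[OF xc] by simp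
  then show ?thesis using mem_cgenideal_prodE[OF xc M] by blast
qed

lemma ZPI_nonmaximal_prime_fixed:
  assumes zpi: "general_ZPI_ring R" and Q: "primeideal Q R" and M: "ideal M R" "Q \<subset> M"
    and x: "x \<in> Q"
  shows "\<exists>m\<in>M. x = x \<otimes> m"
  using assms by (intro ZPI_element_fixed[OF zpi Q M(1) _ x] ZPI_prime_absorbs_larger_ideal) auto

text \<open>Both \<open>M\<close> and the primes strictly inside \<open>M\<close> are unchanged by multiplication with \<open>M\<close>. So every
  \<open>x\<close> in \<open>M\<close> is annihilated by some \<open>1 - m\<close> with \<open>m\<close> in \<open>M\<close>, which forces \<open>x\<close> into every prime
  inside \<open>M\<close>.\<close>

lemma ZPI_idempotent_prime_minimal:
  assumes zpi: "general_ZPI_ring R" and M: "primeideal M R" "M \<cdot> M = M"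
    and Q: "primeideal Q R" "Q \<subseteq> M"
  shows "Q = M"
proof (rule subset_antisym[OF Q(2)], rule)
  note M' = ideal_if_prime[OF M(1)]
  note Q' = ideal_if_prime[OF Q(1)]
  fix x assume x: "x \<in> M"
  have "\<exists>m\<in>M. x = x \<otimes> m"
    using M(2) ZPI_prime_absorbs_larger_ideal[OF zpi _ M']
    by (intro ZPI_element_fixed[OF zpi M(1) M' _ x]) blast
  then obtain m where m: "m \<in> M" "x = x \<otimes> m" by blast
  have c: "x \<in> carrier R" "m \<in> carrier R" using m x ideal.Icarr[OF M'] by auto
  have "(\<one> \<ominus> m) \<otimes> x = x \<ominus> x \<otimes> m"
    using c by (simp add: minus_eq l_distr l_minus m_comm[of m x])
  also have "\<dots> = \<zero>" using m(2) c by (simp add: minus_eq r_neg)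
  finally have z: "(\<one> \<ominus> m) \<otimes> x \<in> Q"
    using additive_subgroup.zero_closed[OF ideal.axioms(1)[OF Q']] by simp
  have "\<one> \<ominus> m \<notin> M"
  proof
    assume "\<one> \<ominus> m \<in> M"
    then have "(\<one> \<ominus> m) \<oplus> m \<in> M"
      using m by (intro additive_subgroup.a_closed[OF ideal.axioms(1)[OF M']])
    then have "\<one> \<in> M" using c by (simp add: minus_eq a_assoc l_neg)
    then show False using ideal.one_imp_carrier[OF M'] primeideal.I_notcarr[OF M(1)] by simp
  qed
  then show "x \<in> Q" using primeideal_cancel[OF Q(1) _ c(1) z] c Q(2) by auto
qed

definition minimal_prime :: "'a set \<Rightarrow> bool" where
  "minimal_prime M \<longleftrightarrow> primeideal M R \<and> (\<forall>P. primeideal P R \<longrightarrow> P \<subseteq> M \<longrightarrow> P = M)"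

text \<open>This says that every ideal is a power of \<open>M\<close> locally at \<open>M\<close>: the prime factors different from
  \<open>M\<close> are not contained in \<open>M\<close>, by minimality.\<close>

lemma ZPI_minimal_prime_power_part:
  assumes zpi: "general_ZPI_ring R" and M: "minimal_prime M" and J: "ideal J R"
  shows "\<exists>t C. ideal C R \<and> \<not> C \<subseteq> M \<and> J = ideal_prod_list R (replicate t M) \<cdot> C"
proof -
  have Mp: "primeideal M R" and min: "\<And>P. primeideal P R \<Longrightarrow> P \<subseteq> M \<Longrightarrow> P = M"
    using M unfolding minimal_prime_def by auto
  note M' = ideal_if_prime[OF Mp]
  have rep: "ideal (ideal_prod_list R (replicate t M)) R" for t
    by (intro ideal_prod_list_ideal) (auto simp: M')
  have "\<exists>t C. ideal C R \<and> \<not> C \<subseteq> M \<and>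
      ideal_prod_list R Ps = ideal_prod_list R (replicate t M) \<cdot> C"
    if "\<And>P. P \<in> set Ps \<Longrightarrow> primeideal P R" for Ps
    using that
  proof (induct Ps)
    case Nil
    have "\<not> carrier R \<subseteq> M" using primeideal.I_notcarr[OF Mp] ideal.Icarr[OF M'] by blast
    then show ?case
      by (intro exI[of _ 0] exI[of _ "carrier R"]) (simp add: oneideal ideal_prod_one)
  next
    case (Cons P Ps)
    then obtain t C where tC: "ideal C R" "\<not> C \<subseteq> M"
        "ideal_prod_list R Ps = ideal_prod_list R (replicate t M) \<cdot> C" by auto
    have P: "primeideal P R" using Cons.prems by simp
    show ?case
    proof (cases "P = M")
      case True
      then show ?thesis using tC rep M'
        by (intro exI[of _ "Suc t"] exI[of _ C]) (simp add: ideal_prod_assoc)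
    next
      case False
      then have "\<not> P \<subseteq> M" using min[OF P] by blast
      then have "\<not> P \<cdot> C \<subseteq> M"
        using primeideal_divides_ideal_prod[OF Mp ideal_if_prime[OF P] tC(1)] tC(2) by blast
      then show ?thesis using tC rep ideal_if_prime[OF P]
        by (intro exI[of _ t] exI[of _ "P \<cdot> C"])
          (simp add: ideal_prod_is_ideal ideal_prod_left_commute)
    qed
  qed
  then show ?thesis using ZPI_prime_product[OF zpi J] by metis
qed

text \<open>The element \<open>e\<close> is idempotent and generates \<open>M\<close>. It is the summand in \<open>M\<close> of a decomposition
  of 1 into an element of \<open>M\<close> and a multiple of \<open>b\<close>.\<close>

lemma maximal_annihilated_imp_idempotent_generator:
  assumes M: "maximalideal M R" and b: "b \<in> carrier R" "b \<notin> M"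
    and ann: "\<And>m. m \<in> M \<Longrightarrow> m \<otimes> b = \<zero>"
  shows "\<exists>e\<in>M. \<forall>m\<in>M. e \<otimes> m = m"
proof -
  obtain m c where mc: "m \<in> M" "c \<in> carrier R" "m \<oplus> c \<otimes> b = \<one>"
    using maximalideal_one_decomp[OF M b] by blast
  note Mc = ideal.Icarr[OF maximalideal.axioms(1)[OF M]]
  have "m \<otimes> x = x" if x: "x \<in> M" for x
  proof -
    have "x = (m \<oplus> c \<otimes> b) \<otimes> x" using mc(3) Mc[OF x] by simp
    also have "\<dots> = m \<otimes> x \<oplus> (c \<otimes> b) \<otimes> x"
      using mc(1,2) Mc b(1) x by (intro l_distr) auto
    also have "(c \<otimes> b) \<otimes> x = \<zero>"
      using mc(2) Mc b(1) x ann[OF x] by (simp add: m_assoc m_comm[of b x])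
    finally show ?thesis using mc(1) Mc x by simp
  qed
  then show ?thesis using mc(1) by blast
qed

text \<open>The ideal \<open>M\<close> is a minimal prime, so the zero ideal is \<open>M\<^sup>tC\<close> with \<open>C\<close> not inside \<open>M\<close>. By
  idempotence \<open>MC = 0\<close>, that is, an element outside \<open>M\<close> annihilates \<open>M\<close>.\<close>

lemma ZPI_idempotent_maximal_generator:
  assumes zpi: "general_ZPI_ring R" and M: "maximalideal M R" "idempotent_ideal M R"
  shows "\<exists>e\<in>M. \<forall>m\<in>M. e \<otimes> m = m"
proof -
  have MM: "M \<cdot> M = M" using M(2) unfolding idempotent_ideal_def by blast
  have Mp: "primeideal M R" using maximalideal_prime[OF M(1)] .
  note M' = ideal_if_prime[OF Mp]
  have "minimal_prime M"
    unfolding minimal_prime_def using Mp ZPI_idempotent_prime_minimal[OF zpi Mp MM] by blast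
  from ZPI_minimal_prime_power_part[OF zpi this zeroideal] obtain t C
    where tC: "ideal C R" "\<not> C \<subseteq> M" "{\<zero>} = ideal_prod_list R (replicate t M) \<cdot> C" by blast
  have "M \<subseteq> ideal_prod_list R (replicate t M)"
  proof (induct t)
    case 0
    then show ?case using ideal.Icarr[OF M'] by auto
  next
    case (Suc t)
    then show ?case using ideal_prod_mono[OF subset_refl Suc, of M] MM by simp
  qed
  then have MC: "M \<cdot> C \<subseteq> {\<zero>}" unfolding tC(3) by (intro ideal_prod_mono) auto
  obtain b where b: "b \<in> C" "b \<notin> M" using tC(2) by blast
  show ?thesis
    using MC b ideal.Icarr[OF tC(1)]
    by (intro maximal_annihilated_imp_idempotent_generator[OF M(1), of b]) (auto intro: ideal_prod.prod)
qed

end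

section \<open>OA ideals in rings that are not local\<close>

context cring
begin

lemma maximalideal_member_nonunit:
  assumes "maximalideal M R" "x \<in> M" shows "x \<in> carrier R - Units R"
proof -
  have M': "ideal M R" using assms(1) by (rule maximalideal.axioms(1))
  have "x \<notin> Units R"
  proof
    assume u: "x \<in> Units R"
    then have "inv x \<otimes> x \<in> M" by (intro ideal.I_l_closed[OF M' assms(2)]) simp
    then have "carrier R = M" using ideal.one_imp_carrier[OF M'] Units_l_inv[OF u] by simp
    then show False using maximalideal.I_notcarr[OF assms(1)] by simp
  qed
  then show ?thesis using ideal.Icarr[OF M' assms(2)] by simp
qed

text \<open>Two different maximal ideals are comaximal.\<close>

lemma not_local_imp_nonunits_sum_one:
  assumes "\<one> \<noteq> \<zero>" "\<not> local_ring R"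
  obtains d d' where "d \<in> carrier R - Units R" "d' \<in> carrier R - Units R" "d \<oplus> d' = \<one>"
proof -
  obtain M where M: "maximalideal M R"
    using exists_maximalideal_containing[OF zeroideal] assms(1) by auto
  then obtain N where N: "maximalideal N R" "N \<noteq> M"
    using assms(2) is_cring unfolding local_ring_def by blast
  note M' = maximalideal.axioms(1)[OF M] and N' = maximalideal.axioms(1)[OF N(1)]
  have "\<not> N \<subseteq> M"
  proof
    assume "N \<subseteq> M"
    then have "M = N \<or> M = carrier R"
      using maximalideal.I_maximal[OF N(1) M'] ideal.Icarr[OF M'] by blast
    then show False using N(2) maximalideal.I_notcarr[OF M] by auto
  qed
  then obtain m j where "m \<in> M" "j \<in> N" "m \<oplus> j = \<one>"
    using maximalideal_comaximal[OF M N'] by blast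
  then show thesis
    using that maximalideal_member_nonunit[OF M] maximalideal_member_nonunit[OF N(1)] by blast
qed

lemma finprod_atLeastAtMost_Suc:
  assumes "\<And>i. i \<in> {1..Suc k} \<Longrightarrow> f i \<in> carrier R"
  shows "(\<Otimes>i\<in>{1..Suc k}. f i) = (\<Otimes>i\<in>{1..k}. f i) \<otimes> f (Suc k)"
proof -
  have "(\<Otimes>i\<in>insert (Suc k) {1..k}. f i) = f (Suc k) \<otimes> (\<Otimes>i\<in>{1..k}. f i)"
    using assms by (intro finprod_insert) auto
  moreover have "insert (Suc k) {1..k} = {1..Suc k}" by auto
  moreover have "(\<Otimes>i\<in>{1..k}. f i) \<in> carrier R"
    using assms by (intro finprod_closed) auto
  moreover have "f (Suc k) \<in> carrier R" using assms by auto
  ultimately show ?thesis using m_comm by metis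
qed

lemma prime_imp_n_OA_ideal:
  assumes P: "primeideal P R" shows "n_OA_ideal n P R"
  unfolding n_OA_ideal_def proper_ideal_def
proof (intro conjI allI impI)
  show "ideal P R" by (rule ideal_if_prime[OF P])
  show "P \<noteq> carrier R" using primeideal.I_notcarr[OF P] by simp
  fix a :: "nat \<Rightarrow> 'a"
  assume a: "\<forall>i\<in>{1..n+1}. a i \<in> carrier R - Units R" and fin: "(\<Otimes>i\<in>{1..n+1}. a i) \<in> P"
  have "(\<Otimes>i\<in>{1..Suc n}. a i) = (\<Otimes>i\<in>{1..n}. a i) \<otimes> a (Suc n)"
    using a by (intro finprod_atLeastAtMost_Suc) auto
  moreover have "(\<Otimes>i\<in>{1..n}. a i) \<in> carrier R" using a by (intro finprod_closed) auto
  ultimately show "(\<Otimes>i\<in>{1..n}. a i) \<in> P \<or> a (n + 1) \<in> P"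
    using primeideal.I_prime[OF P, of "\<Otimes>i\<in>{1..n}. a i" "a (Suc n)"] fin a by auto
qed

lemma n_OA_ideal_1_imp_prime:
  assumes I: "n_OA_ideal 1 I R" shows "primeideal I R"
proof (rule primeidealI)
  show I': "ideal I R" and "carrier R \<noteq> I"
    using I unfolding n_OA_ideal_def proper_ideal_def by auto
  show "cring R" ..
  fix a b assume ab: "a \<in> carrier R" "b \<in> carrier R" "a \<otimes> b \<in> I"
  consider "a \<in> Units R" | "b \<in> Units R" | "a \<notin> Units R" "b \<notin> Units R" by blast
  then show "a \<in> I \<or> b \<in> I"
  proof cases
    case 1
    then have "inv a \<otimes> (a \<otimes> b) = b" using ab by (simp add: m_assoc[symmetric])
    then show ?thesis using ideal.I_l_closed[OF I' ab(3), of "inv a"] 1 by simp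
  next
    case 2
    then have "(a \<otimes> b) \<otimes> inv b = a" using ab by (simp add: m_assoc)
    then show ?thesis using ideal.I_r_closed[OF I' ab(3), of "inv b"] 2 by simp
  next
    case 3
    define f where "f = (\<lambda>i::nat. if i = 1 then a else b)"
    have f1: "(\<Otimes>i\<in>{1..1}. f i) = a" using ab(1) by (simp add: f_def)
    have "(\<Otimes>i\<in>{1..Suc 1}. f i) = (\<Otimes>i\<in>{1..1}. f i) \<otimes> f (Suc 1)"
      using ab by (intro finprod_atLeastAtMost_Suc) (auto simp: f_def)
    then have "(\<Otimes>i\<in>{1..1+1}. f i) \<in> I" using ab(3) f1 by (simp add: f_def)
    moreover have "\<forall>i\<in>{1..1+1}. f i \<in> carrier R - Units R" using 3 ab by (simp add: f_def)
    ultimately have "(\<Otimes>i\<in>{1..1}. f i) \<in> I \<or> f (1+1) \<in> I"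
      using I unfolding n_OA_ideal_def by blast
    then show ?thesis using f1 by (simp add: f_def)
  qed
qed

text \<open>Let the product of \<open>p = a\<^sub>1 \<dots> a\<^sub>n\<close> and \<open>a\<^sub>n\<^sub>+\<^sub>1\<close> be in \<open>I\<close>, but not \<open>a\<^sub>n\<^sub>+\<^sub>1\<close>. For every nonunit
  \<open>x\<close> the longer product with the additional factor \<open>x\<close> is in \<open>I\<close>, so \<open>px\<close> is in \<open>I\<close>. Taking
  \<open>d\<close> and \<open>d'\<close> for \<open>x\<close> and adding gives \<open>p\<close> in \<open>I\<close>.\<close>

lemma n_OA_ideal_pred:
  assumes d: "d \<in> carrier R - Units R" "d' \<in> carrier R - Units R" "d \<oplus> d' = \<one>"
    and I: "n_OA_ideal (Suc n) I R"
  shows "n_OA_ideal n I R"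
  unfolding n_OA_ideal_def
proof (intro conjI allI impI)
  show "proper_ideal I R" using I unfolding n_OA_ideal_def by blast
  then have I': "ideal I R" unfolding proper_ideal_def by blast
  fix a :: "nat \<Rightarrow> 'a"
  assume a: "\<forall>i\<in>{1..n+1}. a i \<in> carrier R - Units R" and fin: "(\<Otimes>i\<in>{1..n+1}. a i) \<in> I"
  define p where "p = (\<Otimes>i\<in>{1..n}. a i)"
  have pc: "p \<in> carrier R" using a unfolding p_def by (intro finprod_closed) auto
  have ac: "a (Suc n) \<in> carrier R" using a by auto
  have "(\<Otimes>i\<in>{1..Suc n}. a i) = p \<otimes> a (Suc n)"
    unfolding p_def using a by (intro finprod_atLeastAtMost_Suc) auto
  then have pa: "p \<otimes> a (Suc n) \<in> I" using fin by simp
  have step: "p \<otimes> x \<in> I" if x: "x \<in> carrier R - Units R" and out: "a (Suc n) \<notin> I" for x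
  proof -
    define b where "b = a(Suc n := x, Suc (Suc n) := a (Suc n))"
    have bc: "\<forall>i\<in>{1..Suc n + 1}. b i \<in> carrier R - Units R"
      using a x by (auto simp: b_def)
    have bp: "(\<Otimes>i\<in>{1..n}. b i) = p"
      unfolding p_def using a by (intro finprod_cong') (auto simp: b_def)
    have b1: "(\<Otimes>i\<in>{1..Suc n}. b i) = p \<otimes> x"
    proof -
      have "(\<Otimes>i\<in>{1..Suc n}. b i) = (\<Otimes>i\<in>{1..n}. b i) \<otimes> b (Suc n)"
        using bc by (intro finprod_atLeastAtMost_Suc) auto
      then show ?thesis unfolding bp by (simp add: b_def)
    qed
    have "(\<Otimes>i\<in>{1..Suc (Suc n)}. b i) = (\<Otimes>i\<in>{1..Suc n}. b i) \<otimes> b (Suc (Suc n))"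
      using bc by (intro finprod_atLeastAtMost_Suc) auto
    also have "\<dots> = (p \<otimes> x) \<otimes> a (Suc n)" unfolding b1 by (simp add: b_def)
    also have "\<dots> = x \<otimes> (p \<otimes> a (Suc n))" using x pc ac by (simp add: m_ac)
    also have "\<dots> \<in> I" using x ideal.I_l_closed[OF I' pa] by simp
    finally have "(\<Otimes>i\<in>{1..Suc n + 1}. b i) \<in> I" by simp
    with bc have "(\<Otimes>i\<in>{1..Suc n}. b i) \<in> I \<or> b (Suc n + 1) \<in> I"
      using I unfolding n_OA_ideal_def by blast
    moreover have "b (Suc n + 1) = a (Suc n)" by (simp add: b_def)
    ultimately show ?thesis using out b1 by simp
  qed
  show "(\<Otimes>i\<in>{1..n}. a i) \<in> I \<or> a (n + 1) \<in> I"
  proof (cases "a (Suc n) \<in> I")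
    case False
    have "p \<otimes> d \<oplus> p \<otimes> d' \<in> I"
      using step[OF d(1) False] step[OF d(2) False]
      by (intro additive_subgroup.a_closed[OF ideal.axioms(1)[OF I']])
    moreover have "p \<otimes> d \<oplus> p \<otimes> d' = p" using d pc by (simp add: r_distr[symmetric])
    ultimately show ?thesis by (simp add: p_def)
  qed simp
qed

lemma n_OA_ideal_iff_prime:
  assumes d: "d \<in> carrier R - Units R" "d' \<in> carrier R - Units R" "d \<oplus> d' = \<one>"
    and n: "n \<ge> 1"
  shows "n_OA_ideal n I R \<longleftrightarrow> primeideal I R"
proof
  assume "n_OA_ideal n I R"
  with n have "n_OA_ideal 1 I R"
  proof (induct n rule: dec_induct)
    case (step n)
    then show ?case using n_OA_ideal_pred[OF d] by blast
  qed
  then show "primeideal I R" by (rule n_OA_ideal_1_imp_prime)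
qed (rule prime_imp_n_OA_ideal)

lemma n_OAF_ring_iff_general_ZPI_ring:
  assumes "d \<in> carrier R - Units R" "d' \<in> carrier R - Units R" "d \<oplus> d' = \<one>"
    and "n \<ge> 1"
  shows "n_OAF_ring n R \<longleftrightarrow> general_ZPI_ring R"
  unfolding n_OAF_ring_def general_ZPI_ring_def n_OA_ideal_iff_prime[OF assms] ..

end

section \<open>Ideals generated by an idempotent\<close>

context cring
begin

lemma idempotent_generator_compl:
  assumes I: "ideal I R" and e: "e \<in> I" "\<And>m. m \<in> I \<Longrightarrow> e \<otimes> m = m"
  shows "m \<in> I \<Longrightarrow> (\<one> \<ominus> e) \<otimes> m = \<zero>"
    and "(\<one> \<ominus> e) \<otimes> (\<one> \<ominus> e) = \<one> \<ominus> e"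
    and "I \<noteq> carrier R \<Longrightarrow> \<one> \<ominus> e \<notin> I"
proof -
  have ec: "e \<in> carrier R" using ideal.Icarr[OF I e(1)] .
  show A: "(\<one> \<ominus> e) \<otimes> m = \<zero>" if m: "m \<in> I" for m
    using e(2)[OF m] ideal.Icarr[OF I m] ec by (simp add: minus_eq l_distr l_minus r_neg)
  have "(\<one> \<ominus> e) \<otimes> (\<one> \<ominus> e) = (\<one> \<ominus> e) \<ominus> (\<one> \<ominus> e) \<otimes> e"
    using ec by (simp add: minus_eq r_distr r_minus)
  then show "(\<one> \<ominus> e) \<otimes> (\<one> \<ominus> e) = \<one> \<ominus> e"
    using A[OF e(1)] ec by (simp add: minus_eq)
  show "\<one> \<ominus> e \<notin> I" if ne: "I \<noteq> carrier R"
  proof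
    assume "\<one> \<ominus> e \<in> I"
    then have "(\<one> \<ominus> e) \<oplus> e \<in> I"
      using e(1) by (intro additive_subgroup.a_closed[OF ideal.axioms(1)[OF I]])
    then have "\<one> \<in> I" using ec by (simp add: minus_eq a_assoc l_neg)
    then show False using ideal.one_imp_carrier[OF I] ne by simp
  qed
qed

text \<open>For ideals generated by idempotents, products are intersections: an element common to all of them
  is multiplied by 1 when it is multiplied by the generators.\<close>

lemma ideal_prod_list_idempotent_generators:
  assumes "\<And>N. N \<in> set Ns \<Longrightarrow> ideal N R \<and> (\<exists>e\<in>N. \<forall>m\<in>N. e \<otimes> m = m)"
  shows "ideal_prod_list R Ns = {a \<in> carrier R. \<forall>N\<in>set Ns. a \<in> N}"
proof
  show "ideal_prod_list R Ns \<subseteq> {a \<in> carrier R. \<forall>N\<in>set Ns. a \<in> N}"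
    using assms ideal_prod_list_subset_member[of Ns] ideal.Icarr[OF ideal_prod_list_ideal[of Ns]]
    by blast
  show "{a \<in> carrier R. \<forall>N\<in>set Ns. a \<in> N} \<subseteq> ideal_prod_list R Ns"
  proof
    fix a assume "a \<in> {a \<in> carrier R. \<forall>N\<in>set Ns. a \<in> N}"
    then show "a \<in> ideal_prod_list R Ns" using assms
    proof (induct Ns)
      case (Cons N Ns)
      obtain e where "e \<in> N" "\<forall>m\<in>N. e \<otimes> m = m" using Cons.prems(2)[of N] by auto
      then have e: "e \<in> N" "e \<otimes> a = a" using Cons.prems(1) by auto
      have "e \<otimes> a \<in> N \<cdot> ideal_prod_list R Ns" using Cons e(1) by (intro ideal_prod.prod) auto
      then show ?case using e(2) by simp
    qed simp
  qed
qed

text \<open>The two factors are the components of \<open>J\<close> in the decomposition of \<open>R\<close> by \<open>p\<close>, each one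
  completed by the whole other component.\<close>

lemma ideal_split_idempotent:
  assumes J: "ideal J R" and p: "p \<in> carrier R" "p \<otimes> p = p"
  shows "J = (J <+> PIdl p) \<cdot> (J <+> PIdl (\<one> \<ominus> p))" (is "_ = ?X \<cdot> ?Y")
proof
  note Jc = ideal.Icarr[OF J]
  let ?q = "\<one> \<ominus> p"
  have q: "?q \<in> carrier R" using p(1) by simp
  have id: "ideal (PIdl p) R" "ideal (PIdl ?q) R" using p(1) q by (auto intro: cgenideal_ideal)
  have pq: "p \<otimes> ?q = \<zero>" using p by (simp add: minus_eq r_distr r_minus r_neg)
  show "J \<subseteq> ?X \<cdot> ?Y"
  proof
    fix j assume j: "j \<in> J"
    have "p \<in> ?X" "?q \<in> ?Y" "j \<in> ?X" "j \<in> ?Y"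
      using subset_set_add_right[OF J id(1)] subset_set_add_right[OF J id(2)]
        subset_set_add_left[OF J id(1)] subset_set_add_left[OF J id(2)]
        cgenideal_self[OF p(1)] cgenideal_self[OF q] j by blast+
    then have "p \<otimes> j \<oplus> j \<otimes> ?q \<in> ?X \<cdot> ?Y" by (intro ideal_prod.intros)
    moreover have "p \<otimes> j \<oplus> j \<otimes> ?q = j"
      using p(1) Jc[OF j] by (simp add: minus_eq r_distr r_minus m_comm[of p j] a_ac r_neg r_neg1 r_neg2)
    ultimately show "j \<in> ?X \<cdot> ?Y" by simp
  qed
  show "?X \<cdot> ?Y \<subseteq> J"
  proof (rule ideal_prod_subset[OF J])
    fix s t assume "s \<in> ?X" "t \<in> ?Y"
    then obtain i a j b where s: "i \<in> J" "a \<in> carrier R" "s = i \<oplus> a \<otimes> p"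
      and t: "j \<in> J" "b \<in> carrier R" "t = j \<oplus> b \<otimes> ?q"
      unfolding mem_add_cgenideal_iff by blast
    have c: "i \<in> carrier R" "j \<in> carrier R" using s t Jc by auto
    have tc: "t \<in> carrier R" using t c q by simp
    have "(a \<otimes> p) \<otimes> (b \<otimes> ?q) = (a \<otimes> b) \<otimes> (p \<otimes> ?q)" using s t p(1) q by (simp add: m_ac)
    also have "\<dots> = \<zero>" unfolding pq using s t by simp
    finally have z: "(a \<otimes> p) \<otimes> (b \<otimes> ?q) = \<zero>" .
    have "s \<otimes> t = i \<otimes> t \<oplus> (a \<otimes> p) \<otimes> t" unfolding s(3) using s(2) c p(1) tc by (intro l_distr) auto
    also have "(a \<otimes> p) \<otimes> t = (a \<otimes> p) \<otimes> j \<oplus> (a \<otimes> p) \<otimes> (b \<otimes> ?q)"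
      unfolding t(3) using s(2) t(2) c p(1) q by (intro r_distr) auto
    also have "\<dots> = (a \<otimes> p) \<otimes> j" unfolding z using s(2) c p(1) by simp
    finally have eq: "s \<otimes> t = i \<otimes> t \<oplus> (a \<otimes> p) \<otimes> j" .
    show "s \<otimes> t \<in> J" unfolding eq
      using ideal.I_r_closed[OF J s(1) tc] ideal.I_l_closed[OF J t(1), of "a \<otimes> p"] s(2) p(1)
      by (intro additive_subgroup.a_closed[OF ideal.axioms(1)[OF J]]) auto
  qed
qed

end

section \<open>Surjective ring homomorphisms\<close>

lemma (in ring_hom_ring) ideal_image:
  assumes surj: "h ` carrier R = carrier S" and I: "ideal I R"
  shows "ideal (h ` I) S"
proof (rule idealI)
  note Ic = ideal.Icarr[OF I]
  show "ring S" by (rule S.ring_axioms)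
  show "subgroup (h ` I) (add_monoid S)"
    by (rule img_is_add_subgroup) (rule additive_subgroup.a_subgroup[OF ideal.axioms(1)[OF I]])
  fix a x assume "a \<in> h ` I" "x \<in> carrier S"
  then obtain i r where ir: "i \<in> I" "r \<in> carrier R" "a = h i" "x = h r" using surj by blast
  have "x \<otimes>\<^bsub>S\<^esub> a = h (r \<otimes> i)" "a \<otimes>\<^bsub>S\<^esub> x = h (i \<otimes> r)" using ir Ic by auto
  then show "x \<otimes>\<^bsub>S\<^esub> a \<in> h ` I" "a \<otimes>\<^bsub>S\<^esub> x \<in> h ` I"
    using ideal.I_l_closed[OF I ir(1,2)] ideal.I_r_closed[OF I ir(1,2)] by auto
qed

lemma (in ring_hom_ring) ideal_prod_image:
  assumes I: "ideal I R" and J: "ideal J R"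
  shows "h ` (I \<cdot> J) = (h ` I) \<cdot>\<^bsub>S\<^esub> (h ` J)"
proof
  note Ic = ideal.Icarr[OF I] and Jc = ideal.Icarr[OF J]
  show "h ` (I \<cdot> J) \<subseteq> (h ` I) \<cdot>\<^bsub>S\<^esub> (h ` J)"
  proof
    fix y assume "y \<in> h ` (I \<cdot> J)"
    then obtain x where x: "x \<in> I \<cdot> J" "y = h x" by blast
    from x(1) have "h x \<in> (h ` I) \<cdot>\<^bsub>S\<^esub> (h ` J)"
    proof induct
      case (prod i j)
      then show ?case using Ic Jc by (auto intro!: ideal_prod.prod)
    next
      case (sum s1 s2)
      then have "s1 \<in> carrier R" "s2 \<in> carrier R"
        using R.ideal_prod_in_carrier[OF I J] by auto
      then show ?case using sum by (auto intro!: ideal_prod.sum)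
    qed
    then show "y \<in> (h ` I) \<cdot>\<^bsub>S\<^esub> (h ` J)" using x(2) by simp
  qed
  show "(h ` I) \<cdot>\<^bsub>S\<^esub> (h ` J) \<subseteq> h ` (I \<cdot> J)"
  proof
    fix y assume "y \<in> (h ` I) \<cdot>\<^bsub>S\<^esub> (h ` J)"
    then show "y \<in> h ` (I \<cdot> J)"
    proof induct
      case (prod a b)
      then obtain i j where ij: "i \<in> I" "j \<in> J" "a = h i" "b = h j" by blast
      then have "a \<otimes>\<^bsub>S\<^esub> b = h (i \<otimes> j)" using Ic Jc by simp
      then show ?case using ij by (auto intro: ideal_prod.prod)
    next
      case (sum a b)
      then obtain s1 s2 where s: "s1 \<in> I \<cdot> J" "s2 \<in> I \<cdot> J" "a = h s1" "b = h s2" by blast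
      then have "s1 \<in> carrier R" "s2 \<in> carrier R"
        using R.ideal_prod_in_carrier[OF I J] by auto
      then have "a \<oplus>\<^bsub>S\<^esub> b = h (s1 \<oplus> s2)" using s by simp
      then show ?case using s by (auto intro: ideal_prod.sum)
    qed
  qed
qed

lemma (in ring_hom_cring) ideal_prod_list_image:
  assumes surj: "h ` carrier R = carrier S" and "\<And>I. I \<in> set Is \<Longrightarrow> ideal I R"
  shows "h ` (ideal_prod_list R Is) = ideal_prod_list S (map ((`) h) Is)"
  using assms(2)
  by (induct Is) (simp_all add: surj ring.ideal_prod_image R.ideal_prod_list_ideal)

lemma (in ring_hom_cring) kernel_in_ideal_vimage_eq:
  assumes "ideal P R" "a_kernel R S h \<subseteq> P" "x \<in> carrier R" "h x \<in> h ` P"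
  shows "x \<in> P"
proof -
  obtain p where p: "p \<in> P" "h x = h p" using assms(4) by blast
  have pc: "p \<in> carrier R" using ideal.Icarr[OF assms(1) p(1)] .
  have "x \<ominus> p \<in> a_kernel R S h"
  proof -
    have "h (x \<ominus> p) = h p \<oplus>\<^bsub>S\<^esub> h (\<ominus> p)"
      using pc assms(3) p(2) by (simp only: R.minus_eq hom_add R.a_inv_closed)
    also have "\<dots> = h (p \<oplus> \<ominus> p)" using pc by (simp only: hom_add R.a_inv_closed)
    also have "\<dots> = \<zero>\<^bsub>S\<^esub>" using pc by (simp only: R.r_neg hom_zero)
    finally show ?thesis unfolding a_kernel_def' using R.minus_closed[OF assms(3) pc] by blast
  qed
  then have "(x \<ominus> p) \<oplus> p \<in> P"
    using assms(2) p(1) by (intro additive_subgroup.a_closed[OF ideal.axioms(1)[OF assms(1)]]) auto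
  then show ?thesis using pc assms(3) by (simp add: R.minus_eq R.a_assoc R.l_neg)
qed

lemma (in ring_hom_cring) primeideal_image:
  assumes surj: "h ` carrier R = carrier S" and P: "primeideal P R" and ker: "a_kernel R S h \<subseteq> P"
  shows "primeideal (h ` P) S"
proof (rule primeidealI)
  note P' = R.ideal_if_prime[OF P]
  note lift = kernel_in_ideal_vimage_eq[OF P' ker]
  show "ideal (h ` P) S" by (rule ring.ideal_image[OF surj P'])
  show "cring S" by (rule S.is_cring)
  show "carrier S \<noteq> h ` P"
  proof
    assume "carrier S = h ` P"
    then have "carrier R \<subseteq> P" using lift surj by blast
    then show False using primeideal.I_notcarr[OF P] ideal.Icarr[OF P'] by blast
  qed
  fix a b assume "a \<in> carrier S" "b \<in> carrier S" and ab: "a \<otimes>\<^bsub>S\<^esub> b \<in> h ` P"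
  then obtain x y where xy: "x \<in> carrier R" "y \<in> carrier R" "a = h x" "b = h y"
    using surj by blast
  then have "x \<otimes> y \<in> P" using lift[of "x \<otimes> y"] ab by simp
  then show "a \<in> h ` P \<or> b \<in> h ` P"
    using primeideal.I_prime[OF P xy(1,2)] xy by blast
qed

text \<open>Factor the preimage of an ideal. Its prime factors contain the kernel, so their images are
  prime.\<close>

lemma (in ring_hom_cring) general_ZPI_ring_image:
  assumes surj: "h ` carrier R = carrier S" and ne: "\<one>\<^bsub>S\<^esub> \<noteq> \<zero>\<^bsub>S\<^esub>" and zpi: "general_ZPI_ring R"
  shows "general_ZPI_ring S"
  unfolding S.general_ZPI_ring_iff
proof (intro conjI allI impI)
  fix I assume I: "ideal I S"
  define J where "J = {r \<in> carrier R. h r \<in> I}"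
  have J: "ideal J R" unfolding J_def by (rule ring.ideal_vimage[OF I])
  have hJ: "h ` J = I" unfolding J_def using surj ideal.Icarr[OF I] by (auto simp: image_iff)
  have ker: "a_kernel R S h \<subseteq> J"
    unfolding J_def a_kernel_def' using additive_subgroup.zero_closed[OF ideal.axioms(1)[OF I]] by auto
  obtain Ps where Ps: "\<And>P. P \<in> set Ps \<Longrightarrow> primeideal P R" "J = ideal_prod_list R Ps"
    using R.ZPI_prime_product[OF zpi J] by blast
  have "primeideal (h ` P) S" if "P \<in> set Ps" for P
    using ker R.ideal_prod_list_subset_member[of Ps P] Ps that R.ideal_if_prime
    by (intro primeideal_image[OF surj]) blast+
  moreover have "I = ideal_prod_list S (map ((`) h) Ps)"
    using ideal_prod_list_image[OF surj, of Ps] Ps R.ideal_if_prime hJ by auto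
  ultimately show "prime_product S I"
    unfolding prime_product_def by (intro exI[of _ "map ((`) h) Ps"]) auto
qed (rule ne)

section \<open>The ring structure of a trivial extension\<close>

context module
begin

abbreviation T where "T \<equiv> trivial_extension R M"

lemma T_simps [simp]:
  "carrier T = carrier R \<times> carrier M"
  "(a, x) \<otimes>\<^bsub>T\<^esub> (b, y) = (a \<otimes> b, a \<odot>\<^bsub>M\<^esub> y \<oplus>\<^bsub>M\<^esub> b \<odot>\<^bsub>M\<^esub> x)"
  "(a, x) \<oplus>\<^bsub>T\<^esub> (b, y) = (a \<oplus> b, x \<oplus>\<^bsub>M\<^esub> y)"
  "\<one>\<^bsub>T\<^esub> = (\<one>, \<zero>\<^bsub>M\<^esub>)"
  "\<zero>\<^bsub>T\<^esub> = (\<zero>, \<zero>\<^bsub>M\<^esub>)"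
  by (simp_all add: trivial_extension_def)

lemma snd_T_add: "snd (s \<oplus>\<^bsub>T\<^esub> t) = snd s \<oplus>\<^bsub>M\<^esub> snd t"
  by (cases s; cases t) simp

lemma T_cring: "cring T"
  by (rule trivial_extension_cring) (rule module_axioms)

interpretation T: cring T by (rule T_cring)

lemma fst_hom: "ring_hom_cring T R fst"
  by (rule ring_hom_cring.intro)
    (auto intro!: T_cring R.is_cring ring_hom_cring_axioms.intro ring_hom_memI)

interpretation fst: ring_hom_cring T R fst by (rule fst_hom)

lemma fst_surj: "fst ` carrier T = carrier R"
  using M.zero_closed by (force simp: image_iff)

lemma fst_kernel: "a_kernel T R fst = {\<zero>} \<times> carrier M"
  unfolding a_kernel_def' by auto

lemma lift_ideal:
  assumes "ideal I R" shows "ideal (I \<times> carrier M) T"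
proof -
  have "I \<times> carrier M = {r \<in> carrier T. fst r \<in> I}" using ideal.Icarr[OF assms] by auto
  then show ?thesis using fst.ring.ideal_vimage[OF assms] by simp
qed

lemma lift_primeideal:
  assumes "primeideal P R" shows "primeideal (P \<times> carrier M) T"
proof (rule primeidealI)
  note P' = R.ideal_if_prime[OF assms]
  show "ideal (P \<times> carrier M) T" by (rule lift_ideal[OF P'])
  show "cring T" by (rule T_cring)
  have "\<one> \<notin> P" using ideal.one_imp_carrier[OF P'] primeideal.I_notcarr[OF assms] by auto
  then show "carrier T \<noteq> P \<times> carrier M" using M.zero_closed by auto
  fix s t assume "s \<in> carrier T" "t \<in> carrier T" "s \<otimes>\<^bsub>T\<^esub> t \<in> P \<times> carrier M"
  then show "s \<in> P \<times> carrier M \<or> t \<in> P \<times> carrier M"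
    using primeideal.I_prime[OF assms, of "fst s" "fst t"] by (cases s; cases t) auto
qed

lemma primeideal_T_kernel:
  assumes "primeideal P T" shows "{\<zero>} \<times> carrier M \<subseteq> P"
proof
  note P' = T.ideal_if_prime[OF assms]
  fix s assume s: "s \<in> {\<zero>} \<times> carrier M"
  then have "s \<otimes>\<^bsub>T\<^esub> s = \<zero>\<^bsub>T\<^esub>" "s \<in> carrier T" by auto
  then show "s \<in> P"
    using primeideal.I_prime[OF assms, of s s]
      additive_subgroup.zero_closed[OF ideal.axioms(1)[OF P']] by auto
qed

lemma ideal_T_eq_lift:
  assumes P: "ideal P T" and ker: "{\<zero>} \<times> carrier M \<subseteq> P"
  shows "P = fst ` P \<times> carrier M"
proof
  show "P \<subseteq> fst ` P \<times> carrier M"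
    using ideal.Icarr[OF P] by (force simp: image_iff)
  show "fst ` P \<times> carrier M \<subseteq> P"
  proof
    fix s assume "s \<in> fst ` P \<times> carrier M"
    then have fs: "fst s \<in> fst ` P" "snd s \<in> carrier M" unfolding mem_Times_iff by blast+
    then have "fst s \<in> carrier R" using ideal.Icarr[OF P] by fastforce
    with fs have "s \<in> carrier T" by (simp add: mem_Times_iff)
    with fs(1) show "s \<in> P"
      using fst.kernel_in_ideal_vimage_eq[OF P] ker fst_kernel by auto
  qed
qed

lemma primeideal_T_cases:
  assumes "primeideal P T"
  shows "primeideal (fst ` P) R" "P = fst ` P \<times> carrier M"
proof -
  note P' = T.ideal_if_prime[OF assms]
  show "primeideal (fst ` P) R"
    using fst.primeideal_image[OF fst_surj assms] primeideal_T_kernel[OF assms] fst_kernel by simp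
  show "P = fst ` P \<times> carrier M"
    by (rule ideal_T_eq_lift[OF P' primeideal_T_kernel[OF assms]])
qed

lemma lift_minimal_prime:
  assumes "R.minimal_prime N" shows "T.minimal_prime (N \<times> carrier M)"
  unfolding T.minimal_prime_def
proof (intro conjI allI impI)
  show "primeideal (N \<times> carrier M) T"
    using assms lift_primeideal unfolding R.minimal_prime_def by blast
  fix P assume P: "primeideal P T" "P \<subseteq> N \<times> carrier M"
  then have "fst ` P \<subseteq> N" by auto
  then have "fst ` P = N"
    using assms primeideal_T_cases(1)[OF P(1)] unfolding R.minimal_prime_def by blast
  then show "P = N \<times> carrier M" using primeideal_T_cases(2)[OF P(1)] by simp
qed

lemma lift_nonunit:
  assumes "d \<in> carrier R - Units R"
  shows "(d, \<zero>\<^bsub>M\<^esub>) \<in> carrier T - Units T"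
proof -
  have "(d, \<zero>\<^bsub>M\<^esub>) \<notin> Units T"
  proof
    assume "(d, \<zero>\<^bsub>M\<^esub>) \<in> Units T"
    then obtain c y where "c \<in> carrier R" "(c, y) \<otimes>\<^bsub>T\<^esub> (d, \<zero>\<^bsub>M\<^esub>) = \<one>\<^bsub>T\<^esub>"
        "(d, \<zero>\<^bsub>M\<^esub>) \<otimes>\<^bsub>T\<^esub> (c, y) = \<one>\<^bsub>T\<^esub>"
      unfolding Units_def by auto
    then have "d \<in> Units R" using assms unfolding Units_def by auto
    then show False using assms by simp
  qed
  then show ?thesis using assms by simp
qed

lemma ZPI_base_if_ZPI_T:
  assumes "\<one> \<noteq> \<zero>" "general_ZPI_ring T" shows "general_ZPI_ring R"
  by (rule fst.general_ZPI_ring_image[OF fst_surj assms])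

section \<open>Local structure of the module\<close>

text \<open>The element \<open>(0, x)\<close> lies in the prime \<open>Q \<times> M\<close>, which is strictly inside \<open>N \<times> M\<close>, so it is fixed
  by multiplication with some element of \<open>N \<times> M\<close>.\<close>

lemma ZPI_T_nonminimal_torsion:
  assumes zpi: "general_ZPI_ring T" and N: "primeideal N R" and Q: "primeideal Q R" "Q \<subset> N"
    and x: "x \<in> carrier M"
  shows "\<exists>s\<in>carrier R - N. s \<odot>\<^bsub>M\<^esub> x = \<zero>\<^bsub>M\<^esub>"
proof -
  note N' = R.ideal_if_prime[OF N] and Q' = R.ideal_if_prime[OF Q(1)]
  have "Q \<times> carrier M \<subset> N \<times> carrier M" using Q(2) M.zero_closed by blast
  moreover have "(\<zero>, x) \<in> Q \<times> carrier M"
    using x additive_subgroup.zero_closed[OF ideal.axioms(1)[OF Q']] by simp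
  ultimately have "\<exists>s\<in>N \<times> carrier M. (\<zero>, x) = (\<zero>, x) \<otimes>\<^bsub>T\<^esub> s"
    by (rule T.ZPI_nonmaximal_prime_fixed[OF zpi lift_primeideal[OF Q(1)] lift_ideal[OF N']])
  then obtain s where s: "s \<in> N \<times> carrier M" "(\<zero>, x) = (\<zero>, x) \<otimes>\<^bsub>T\<^esub> s" ..
  obtain m y where my: "s = (m, y)" "m \<in> N" "y \<in> carrier M" using s(1) by auto
  have mc: "m \<in> carrier R" using ideal.Icarr[OF N' my(2)] .
  have "x = \<zero> \<odot>\<^bsub>M\<^esub> y \<oplus>\<^bsub>M\<^esub> m \<odot>\<^bsub>M\<^esub> x"
    using s(2) unfolding my(1) T_simps by (rule prod.inject[THEN iffD1, THEN conjunct2])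
  also have "\<dots> = m \<odot>\<^bsub>M\<^esub> x" using mc x my(3) by simp
  finally have mx: "m \<odot>\<^bsub>M\<^esub> x = x" by (rule sym)
  have "(\<one> \<ominus> m) \<odot>\<^bsub>M\<^esub> x = \<zero>\<^bsub>M\<^esub>"
    using mc x mx by (simp add: R.minus_eq smult_l_distr smult_l_minus M.r_neg)
  moreover have "\<one> \<ominus> m \<notin> N"
  proof
    assume "\<one> \<ominus> m \<in> N"
    then have "(\<one> \<ominus> m) \<oplus> m \<in> N"
      using my(2) by (intro additive_subgroup.a_closed[OF ideal.axioms(1)[OF N']])
    then have "\<one> \<in> N" using mc by (simp add: R.minus_eq R.a_assoc R.l_neg)
    then show False using ideal.one_imp_carrier[OF N'] primeideal.I_notcarr[OF N] by simp
  qed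
  ultimately show ?thesis using mc by blast
qed

lemma smult_one_minus:
  assumes "a \<in> carrier R" "x \<in> carrier M"
  shows "(\<one> \<ominus> a) \<odot>\<^bsub>M\<^esub> x = x \<oplus>\<^bsub>M\<^esub> \<ominus>\<^bsub>M\<^esub> (a \<odot>\<^bsub>M\<^esub> x)"
  using assms by (simp add: R.minus_eq smult_l_distr smult_l_minus)

lemma kernel_ideal: "ideal ({\<zero>} \<times> carrier M) T"
  by (rule lift_ideal[OF R.zeroideal])

text \<open>If \<open>f\<close> annihilates \<open>N\<close>, then it annihilates \<open>NM\<close>, which contains the module components of
  the square of \<open>N \<times> M\<close>.\<close>

lemma lift_square_annihilates:
  assumes N: "ideal N R" and f: "f \<in> carrier R" "\<And>n. n \<in> N \<Longrightarrow> f \<otimes> n = \<zero>"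
    and s: "s \<in> (N \<times> carrier M) \<cdot>\<^bsub>T\<^esub> (N \<times> carrier M)"
  shows "snd s \<in> carrier M \<and> f \<odot>\<^bsub>M\<^esub> snd s = \<zero>\<^bsub>M\<^esub>"
  using s
proof induct
  case (prod i j)
  then obtain n x m y where ij: "i = (n, x)" "j = (m, y)" "n \<in> N" "m \<in> N" "x \<in> carrier M" "y \<in> carrier M"
    by blast
  have c: "n \<in> carrier R" "m \<in> carrier R" using ij ideal.Icarr[OF N] by auto
  have "f \<odot>\<^bsub>M\<^esub> (n \<odot>\<^bsub>M\<^esub> y) = \<zero>\<^bsub>M\<^esub>" "f \<odot>\<^bsub>M\<^esub> (m \<odot>\<^bsub>M\<^esub> x) = \<zero>\<^bsub>M\<^esub>"
    using c ij f by (simp_all add: smult_assoc1[symmetric])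
  then show ?case using ij c f(1) by (simp add: smult_r_distr)
next
  case (sum s t)
  then show ?case using f(1) by (simp add: snd_T_add smult_r_distr)
qed

text \<open>Module components of the square of \<open>N \<times> M\<close> lie in \<open>NM\<close>. The submodule \<open>NM\<close> is expressed by
  the ideal \<open>0 \<times> NM\<close> of \<open>T\<close>, the product of \<open>N \<times> M\<close> and \<open>0 \<times> M\<close>.\<close>

lemma lift_square_snd:
  assumes N: "ideal N R" and s: "s \<in> (N \<times> carrier M) \<cdot>\<^bsub>T\<^esub> (N \<times> carrier M)"
  shows "(\<zero>, snd s) \<in> (N \<times> carrier M) \<cdot>\<^bsub>T\<^esub> ({\<zero>} \<times> carrier M) \<and> snd s \<in> carrier M"
  using s
proof induct
  case (prod i j)
  then obtain n x m y where ij: "i = (n, x)" "j = (m, y)" "n \<in> N" "m \<in> N" "x \<in> carrier M" "y \<in> carrier M"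
    by blast
  have c: "n \<in> carrier R" "m \<in> carrier R" using ij ideal.Icarr[OF N] by auto
  have "(n, \<zero>\<^bsub>M\<^esub>) \<otimes>\<^bsub>T\<^esub> (\<zero>, y) \<in> (N \<times> carrier M) \<cdot>\<^bsub>T\<^esub> ({\<zero>} \<times> carrier M)"
    "(m, \<zero>\<^bsub>M\<^esub>) \<otimes>\<^bsub>T\<^esub> (\<zero>, x) \<in> (N \<times> carrier M) \<cdot>\<^bsub>T\<^esub> ({\<zero>} \<times> carrier M)"
    using ij by (auto intro!: ideal_prod.prod simp del: T_simps)
  from ideal_prod.sum[OF this] show ?case using ij c by simp
next
  case (sum s t)
  then have "(\<zero>, snd s) \<oplus>\<^bsub>T\<^esub> (\<zero>, snd t) \<in> (N \<times> carrier M) \<cdot>\<^bsub>T\<^esub> ({\<zero>} \<times> carrier M)"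
    by (intro ideal_prod.sum) auto
  then show ?case using sum by (simp add: snd_T_add)
qed

text \<open>Let \<open>NN = N \<times> M\<close> and \<open>Z = 0 \<times> M\<close>. Locally at \<open>NN\<close> the ideal \<open>Z\<close> is a power of \<open>NN\<close> with a
  positive exponent. If the exponent is 1, then \<open>NN\<close> and \<open>Z\<close> agree locally, so \<open>N\<close> is locally zero and
  thus generated by an idempotent \<open>e\<close>. If \<open>(1 - e)x\<close> is not 0, then \<open>(0, x)\<close> is
  not in the square of \<open>NN\<close>, so the ideal that it generates is locally \<open>NN\<close> as well, and contains
  \<open>0 \<times> (1 - e)M\<close>. If the
  exponent is at least 2, then \<open>M = NM\<close>, hence \<open>Z\<close> is unchanged by multiplication with \<open>NN\<close>. As some
  power of \<open>NN\<close> is locally zero, so is \<open>Z\<close>.\<close>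

lemma ZPI_T_minimal_dichotomy:
  assumes zpi: "general_ZPI_ring T" and N: "maximalideal N R" and min: "R.minimal_prime N"
  shows "(\<exists>s\<in>carrier R - N. \<forall>x\<in>carrier M. s \<odot>\<^bsub>M\<^esub> x = \<zero>\<^bsub>M\<^esub>) \<or>
    (\<exists>e\<in>N. (\<forall>n\<in>N. e \<otimes> n = n) \<and>
      (\<forall>x\<in>carrier M. \<forall>z\<in>carrier M. (\<one> \<ominus> e) \<odot>\<^bsub>M\<^esub> x \<noteq> \<zero>\<^bsub>M\<^esub> \<longrightarrow>
        (\<exists>r\<in>carrier R. (\<one> \<ominus> e) \<odot>\<^bsub>M\<^esub> z = r \<odot>\<^bsub>M\<^esub> x)))"
proof -
  define NN where "NN = N \<times> carrier M"
  define Z where "Z = {\<zero>} \<times> carrier M"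
  have N': "ideal N R" using N by (rule maximalideal.axioms(1))
  have NN: "ideal NN T" unfolding NN_def by (rule lift_ideal[OF N'])
  have Z: "ideal Z T" unfolding Z_def by (rule kernel_ideal)
  have zN: "\<zero> \<in> N" using additive_subgroup.zero_closed[OF ideal.axioms(1)[OF N']] .
  have ZNN: "Z \<subseteq> NN" using zN unfolding Z_def NN_def by auto
  have pw: "ideal (ideal_prod_list T (replicate t NN)) T" for t
    by (intro T.ideal_prod_list_ideal) (auto simp: NN)
  note power_part = T.ZPI_minimal_prime_power_part[OF zpi lift_minimal_prime[OF min], folded NN_def]
  have outside: "\<exists>b y. b \<in> carrier R - N \<and> y \<in> carrier M \<and> (b, y) \<in> C"
    if C: "ideal C T" "\<not> C \<subseteq> NN" for C
  proof -
    obtain s where s: "s \<in> C" "s \<notin> NN" using C(2) by blast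
    moreover have "s \<in> carrier T" by (rule ideal.Icarr[OF C(1) s(1)])
    ultimately show ?thesis unfolding NN_def by (cases s) auto
  qed
  \<comment> \<open>The exponent 0 is excluded, because \<open>I\<close> lies in \<open>NN\<close> and \<open>C\<close> does not.\<close>
  have exponent: "I = NN \<cdot>\<^bsub>T\<^esub> C \<or> I \<subseteq> NN \<cdot>\<^bsub>T\<^esub> NN"
    if I: "I \<subseteq> NN" and C: "ideal C T" "\<not> C \<subseteq> NN"
      and eq: "I = ideal_prod_list T (replicate t NN) \<cdot>\<^bsub>T\<^esub> C" for I C t
  proof -
    consider "t = 0" | "t = 1" | k where "t = Suc (Suc k)"
      by (metis One_nat_def not0_implies_Suc)
    then show ?thesis
    proof cases
      case 1
      then show ?thesis using eq I C T.ideal_prod_one_left[OF C(1)] by simp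
    next
      case 2
      then show ?thesis using eq T.ideal_prod_one[OF NN] by simp
    next
      case 3
      have "I \<subseteq> ideal_prod_list T (replicate t NN)"
        unfolding eq by (rule T.ideal_prod_subset_left[OF pw C(1)])
      also have "\<dots> \<subseteq> NN \<cdot>\<^bsub>T\<^esub> NN"
        unfolding 3 replicate_Suc T.ideal_prod_list_Cons
        by (rule T.ideal_prod_mono[OF subset_refl T.ideal_prod_subset_left[OF NN pw]])
      finally show ?thesis by blast
    qed
  qed
  obtain t C where C: "ideal C T" "\<not> C \<subseteq> NN" "Z = ideal_prod_list T (replicate t NN) \<cdot>\<^bsub>T\<^esub> C"
    using power_part[OF Z] by blast
  from exponent[OF ZNN C] show ?thesis
  proof
    assume ZC: "Z = NN \<cdot>\<^bsub>T\<^esub> C"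
    obtain b y where b: "b \<in> carrier R - N" "y \<in> carrier M" "(b, y) \<in> C"
      using outside[OF C(1,2)] by blast
    have "n \<otimes> b = \<zero>" if n: "n \<in> N" for n
    proof -
      have "(n, \<zero>\<^bsub>M\<^esub>) \<otimes>\<^bsub>T\<^esub> (b, y) \<in> Z"
        unfolding ZC using n b(3) by (intro ideal_prod.prod) (auto simp: NN_def)
      then show ?thesis by (simp add: Z_def)
    qed
    then obtain e where e: "e \<in> N" "\<And>n. n \<in> N \<Longrightarrow> e \<otimes> n = n"
      using R.maximal_annihilated_imp_idempotent_generator[OF N, of b] b(1) by blast
    have ec: "e \<in> carrier R" using ideal.Icarr[OF N' e(1)] .
    define f where "f = \<one> \<ominus> e"
    have fc: "f \<in> carrier R" using ec by (simp add: f_def)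
    have fn: "f \<otimes> n = \<zero>" if "n \<in> N" for n
      using e(2)[OF that] ideal.Icarr[OF N' that] ec
      by (simp add: f_def R.minus_eq R.l_distr R.l_minus R.r_neg)
    have "\<exists>r\<in>carrier R. f \<odot>\<^bsub>M\<^esub> z = r \<odot>\<^bsub>M\<^esub> x"
      if x: "x \<in> carrier M" and z: "z \<in> carrier M" and fx: "f \<odot>\<^bsub>M\<^esub> x \<noteq> \<zero>\<^bsub>M\<^esub>" for x z
    proof -
      have zx: "(\<zero>, x) \<in> carrier T" using x by simp
      let ?K = "PIdl\<^bsub>T\<^esub> (\<zero>, x)"
      have K: "ideal ?K T" by (rule T.cgenideal_ideal[OF zx])
      have "(\<zero>, x) \<in> NN" using x zN by (simp add: NN_def)
      then have KNN: "?K \<subseteq> NN" by (rule T.cgenideal_minimal[OF NN])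
      obtain u D where D: "ideal D T" "\<not> D \<subseteq> NN" "?K = ideal_prod_list T (replicate u NN) \<cdot>\<^bsub>T\<^esub> D"
        using power_part[OF K] by blast
      have "\<not> ?K \<subseteq> NN \<cdot>\<^bsub>T\<^esub> NN"
      proof
        assume "?K \<subseteq> NN \<cdot>\<^bsub>T\<^esub> NN"
        then have "(\<zero>, x) \<in> NN \<cdot>\<^bsub>T\<^esub> NN" using T.cgenideal_self[OF zx] by blast
        then show False
          using lift_square_annihilates[OF N' fc fn, of "(\<zero>, x)"] fx by (simp add: NN_def)
      qed
      then have KD: "?K = NN \<cdot>\<^bsub>T\<^esub> D" using exponent[OF KNN D] by blast
      obtain b y where b: "b \<in> carrier R - N" "y \<in> carrier M" "(b, y) \<in> D"
        using outside[OF D(1,2)] by blast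
      have "(\<zero>, z) \<otimes>\<^bsub>T\<^esub> (b, y) \<in> ?K"
        unfolding KD using z b(3) zN by (intro ideal_prod.prod) (auto simp: NN_def)
      then obtain r w where rw: "r \<in> carrier R" "w \<in> carrier M"
          "(\<zero>, z) \<otimes>\<^bsub>T\<^esub> (b, y) = (r, w) \<otimes>\<^bsub>T\<^esub> (\<zero>, x)"
        unfolding T.mem_cgenideal_iff by auto
      have bz: "b \<odot>\<^bsub>M\<^esub> z = r \<odot>\<^bsub>M\<^esub> x" using rw b z x by simp
      obtain n c where nc: "n \<in> N" "c \<in> carrier R" "n \<oplus> c \<otimes> b = \<one>"
        using R.maximalideal_one_decomp[OF N, of b] b(1) by blast
      have ncarr: "n \<in> carrier R" using ideal.Icarr[OF N' nc(1)] .
      have "f = f \<otimes> (n \<oplus> c \<otimes> b)" using nc(3) fc by simp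
      also have "\<dots> = (f \<otimes> c) \<otimes> b"
        using fn[OF nc(1)] fc nc(2) b(1) ncarr by (simp add: R.r_distr R.m_assoc)
      finally have "f \<odot>\<^bsub>M\<^esub> z = (f \<otimes> c) \<odot>\<^bsub>M\<^esub> (b \<odot>\<^bsub>M\<^esub> z)"
        using fc nc(2) b(1) z smult_assoc1[of "f \<otimes> c" b z] by simp
      also have "\<dots> = (f \<otimes> c \<otimes> r) \<odot>\<^bsub>M\<^esub> x"
        unfolding bz using fc nc(2) rw(1) x by (simp add: smult_assoc1)
      finally show ?thesis using fc nc(2) rw(1) by blast
    qed
    then show ?thesis using e unfolding f_def by blast
  next
    assume ZNN2: "Z \<subseteq> NN \<cdot>\<^bsub>T\<^esub> NN"
    have Z_abs: "NN \<cdot>\<^bsub>T\<^esub> Z = Z"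
    proof
      show "NN \<cdot>\<^bsub>T\<^esub> Z \<subseteq> Z" by (rule T.ideal_prod_subset_right[OF NN Z])
      show "Z \<subseteq> NN \<cdot>\<^bsub>T\<^esub> Z"
      proof
        fix s assume s: "s \<in> Z"
        then have "s \<in> NN \<cdot>\<^bsub>T\<^esub> NN" using ZNN2 by blast
        then have "(\<zero>, snd s) \<in> NN \<cdot>\<^bsub>T\<^esub> Z"
          using lift_square_snd[OF N'] unfolding NN_def Z_def by blast
        moreover have "(\<zero>, snd s) = s" using s unfolding Z_def by auto
        ultimately show "s \<in> NN \<cdot>\<^bsub>T\<^esub> Z" by simp
      qed
    qed
    have Z_abs_pow: "ideal_prod_list T (replicate u NN) \<cdot>\<^bsub>T\<^esub> Z = Z" for u
    proof (induct u)
      case 0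
      then show ?case using T.ideal_prod_one_left[OF Z] by simp
    next
      case (Suc u)
      then show ?case using T.ideal_prod_assoc[OF NN pw Z] Z_abs by simp
    qed
    obtain u D where D: "ideal D T" "\<not> D \<subseteq> NN" "{\<zero>\<^bsub>T\<^esub>} = ideal_prod_list T (replicate u NN) \<cdot>\<^bsub>T\<^esub> D"
      using power_part[OF T.zeroideal] by blast
    have "Z \<cdot>\<^bsub>T\<^esub> D = (ideal_prod_list T (replicate u NN) \<cdot>\<^bsub>T\<^esub> Z) \<cdot>\<^bsub>T\<^esub> D"
      using Z_abs_pow by simp
    also have "\<dots> = Z \<cdot>\<^bsub>T\<^esub> {\<zero>\<^bsub>T\<^esub>}"
      unfolding D(3) using T.ideal_prod_commute[OF pw Z] T.ideal_prod_assoc[OF Z pw D(1)] by simp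
    also have "\<dots> = {\<zero>\<^bsub>T\<^esub>}" by (rule T.ideal_prod_zero[OF Z])
    finally have ZD: "Z \<cdot>\<^bsub>T\<^esub> D = {\<zero>\<^bsub>T\<^esub>}" .
    obtain b y where b: "b \<in> carrier R - N" "y \<in> carrier M" "(b, y) \<in> D"
      using outside[OF D(1,2)] by blast
    have "b \<odot>\<^bsub>M\<^esub> x = \<zero>\<^bsub>M\<^esub>" if x: "x \<in> carrier M" for x
    proof -
      have "(\<zero>, x) \<otimes>\<^bsub>T\<^esub> (b, y) \<in> Z \<cdot>\<^bsub>T\<^esub> D"
        using x b(3) by (intro ideal_prod.prod) (auto simp: Z_def)
      then have "(\<zero>, x) \<otimes>\<^bsub>T\<^esub> (b, y) = \<zero>\<^bsub>T\<^esub>" unfolding ZD by blast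
      then show ?thesis using x b by simp
    qed
    then show ?thesis using b(1) by blast
  qed
qed

text \<open>Membership in a cyclic submodule is a local property: the ideal of all \<open>a\<close> that multiply \<open>y\<close> into
  the submodule generated by \<open>x\<close> is contained in no maximal ideal.\<close>

lemma local_membership:
  assumes x: "x \<in> carrier M" and y: "y \<in> carrier M"
    and loc: "\<And>N. maximalideal N R \<Longrightarrow> \<exists>s\<in>carrier R - N. \<exists>r\<in>carrier R. s \<odot>\<^bsub>M\<^esub> y = r \<odot>\<^bsub>M\<^esub> x"
  shows "\<exists>r\<in>carrier R. y = r \<odot>\<^bsub>M\<^esub> x"
proof -
  define I where "I = {a \<in> carrier R. \<exists>r\<in>carrier R. a \<odot>\<^bsub>M\<^esub> y = r \<odot>\<^bsub>M\<^esub> x}"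
  have I: "ideal I R"
  proof (rule idealI)
    show "ring R" ..
    show "subgroup I (add_monoid R)"
    proof
      show "I \<subseteq> carrier (add_monoid R)" by (auto simp: I_def)
      show "\<one>\<^bsub>add_monoid R\<^esub> \<in> I" using x y by (auto simp: I_def intro!: bexI[of _ \<zero>])
      fix a assume "a \<in> I"
      then obtain r where a: "a \<in> carrier R" "r \<in> carrier R" "a \<odot>\<^bsub>M\<^esub> y = r \<odot>\<^bsub>M\<^esub> x"
        by (auto simp: I_def)
      have "(\<ominus> a) \<odot>\<^bsub>M\<^esub> y = (\<ominus> r) \<odot>\<^bsub>M\<^esub> x" using a x y by (simp add: smult_l_minus)
      then show "inv\<^bsub>add_monoid R\<^esub> a \<in> I"
        using a unfolding I_def a_inv_def[symmetric] by blast
      fix b assume "b \<in> I"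
      then obtain q where b: "b \<in> carrier R" "q \<in> carrier R" "b \<odot>\<^bsub>M\<^esub> y = q \<odot>\<^bsub>M\<^esub> x"
        by (auto simp: I_def)
      have "(a \<oplus> b) \<odot>\<^bsub>M\<^esub> y = (r \<oplus> q) \<odot>\<^bsub>M\<^esub> x" using a b x y by (simp add: smult_l_distr)
      then show "a \<otimes>\<^bsub>add_monoid R\<^esub> b \<in> I" using a b unfolding I_def by auto
    qed
    fix a c assume "a \<in> I" and c: "c \<in> carrier R"
    then obtain r where a: "a \<in> carrier R" "r \<in> carrier R" "a \<odot>\<^bsub>M\<^esub> y = r \<odot>\<^bsub>M\<^esub> x"
      by (auto simp: I_def)
    have "(c \<otimes> a) \<odot>\<^bsub>M\<^esub> y = (c \<otimes> r) \<odot>\<^bsub>M\<^esub> x" using a c x y by (simp add: smult_assoc1)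
    then show "c \<otimes> a \<in> I" using a c unfolding I_def by blast
    then show "a \<otimes> c \<in> I" using R.m_comm[OF a(1) c] by simp
  qed
  have "\<one> \<in> I"
  proof (rule ccontr)
    assume "\<one> \<notin> I"
    then obtain N where N: "maximalideal N R" "I \<subseteq> N"
      using R.exists_maximalideal_containing[OF I] by blast
    then show False using loc[OF N(1)] unfolding I_def by blast
  qed
  then show ?thesis using y unfolding I_def by auto
qed

section \<open>Cyclicity of the module\<close>

text \<open>The set \<open>S\<close> in the proof is the support of \<open>M\<close> among the maximal ideals: outside \<open>S\<close> the local
  module is zero, and at a member of \<open>S\<close> it is one-dimensional, cut out by an idempotent.\<close>

lemma ZPI_T_imp_cyclic:
  assumes ne: "\<one> \<noteq> \<zero>" and zpi: "general_ZPI_ring T"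
  shows "cyclic_module R M \<and> (\<exists>Ps. (\<forall>P\<in>set Ps. maximalideal P R \<and> idempotent_ideal P R) \<and>
            annihilator R M = ideal_prod_list R Ps)"
proof -
  have zpiR: "general_ZPI_ring R" by (rule ZPI_base_if_ZPI_T[OF ne zpi])
  define S where "S = {N. maximalideal N R \<and> (\<exists>x\<in>carrier M. \<forall>s\<in>carrier R - N. s \<odot>\<^bsub>M\<^esub> x \<noteq> \<zero>\<^bsub>M\<^esub>)}"
  have max: "maximalideal N R" if "N \<in> S" for N using that by (simp add: S_def)
  have id: "ideal N R" if "N \<in> S" for N using max[OF that] by (rule maximalideal.axioms(1))
  have prime: "primeideal N R" if "N \<in> S" for N using R.maximalideal_prime[OF max[OF that]] .
  have min: "R.minimal_prime N" if N: "N \<in> S" for N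
  proof -
    obtain x where x: "x \<in> carrier M" "\<forall>s\<in>carrier R - N. s \<odot>\<^bsub>M\<^esub> x \<noteq> \<zero>\<^bsub>M\<^esub>"
      using N unfolding S_def by blast
    have "Q = N" if Q: "primeideal Q R" "Q \<subseteq> N" for Q
    proof (rule ccontr)
      assume "Q \<noteq> N"
      then have "Q \<subset> N" using Q(2) by blast
      then show False using ZPI_T_nonminimal_torsion[OF zpi prime[OF N] Q(1) _ x(1)] x(2) by blast
    qed
    then show ?thesis unfolding R.minimal_prime_def using prime[OF N] by blast
  qed
  have "\<exists>e\<in>N. (\<forall>n\<in>N. e \<otimes> n = n) \<and>
      (\<forall>x\<in>carrier M. \<forall>z\<in>carrier M. (\<one> \<ominus> e) \<odot>\<^bsub>M\<^esub> x \<noteq> \<zero>\<^bsub>M\<^esub> \<longrightarrow>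
        (\<exists>r\<in>carrier R. (\<one> \<ominus> e) \<odot>\<^bsub>M\<^esub> z = r \<odot>\<^bsub>M\<^esub> x))" if N: "N \<in> S" for N
    using ZPI_T_minimal_dichotomy[OF zpi max[OF N] min[OF N]] N unfolding S_def by blast
  then obtain e where e: "\<And>N. N \<in> S \<Longrightarrow> e N \<in> N" "\<And>N n. N \<in> S \<Longrightarrow> n \<in> N \<Longrightarrow> e N \<otimes> n = n"
    and simple: "\<And>N x z. N \<in> S \<Longrightarrow> x \<in> carrier M \<Longrightarrow> z \<in> carrier M \<Longrightarrow> (\<one> \<ominus> e N) \<odot>\<^bsub>M\<^esub> x \<noteq> \<zero>\<^bsub>M\<^esub> \<Longrightarrow>
        \<exists>r\<in>carrier R. (\<one> \<ominus> e N) \<odot>\<^bsub>M\<^esub> z = r \<odot>\<^bsub>M\<^esub> x"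
    by metis
  define f where "f N = \<one> \<ominus> e N" for N
  have ec: "e N \<in> carrier R" if "N \<in> S" for N using ideal.Icarr[OF id[OF that] e(1)[OF that]] .
  have fc: "f N \<in> carrier R" if "N \<in> S" for N using ec[OF that] by (simp add: f_def)
  have fn: "f N \<otimes> n = \<zero>" if "N \<in> S" "n \<in> N" for N n
    unfolding f_def using R.idempotent_generator_compl(1)[OF id[OF that(1)] e(1,2)] that by blast
  have f_out: "f N \<notin> N" if N: "N \<in> S" for N
  proof -
    have "N \<noteq> carrier R" using primeideal.I_notcarr[OF prime[OF N]] by simp
    then show ?thesis
      unfolding f_def using R.idempotent_generator_compl(3)[OF id[OF N] e(1)[OF N]] e(2)[OF N] by blast
  qed
  have orth: "f N \<otimes> f N' = \<zero>" if N: "N \<in> S" "N' \<in> S" "N \<noteq> N'" for N N'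
  proof -
    have "\<not> N' \<subseteq> N" using min[OF N(1)] prime[OF N(2)] N(3) unfolding R.minimal_prime_def by blast
    then obtain m where m: "m \<in> N'" "m \<notin> N" by blast
    have mc: "m \<in> carrier R" using ideal.Icarr[OF id[OF N(2)] m(1)] .
    have "m \<otimes> f N' = \<zero>" using fn[OF N(2) m(1)] mc fc[OF N(2)] by (simp add: R.m_comm)
    then have "m \<otimes> f N' \<in> N"
      using additive_subgroup.zero_closed[OF ideal.axioms(1)[OF id[OF N(1)]]] by simp
    then have "f N' \<in> N" using R.primeideal_cancel[OF prime[OF N(1)] mc fc[OF N(2)] _ m(2)] by blast
    then show ?thesis by (rule fn[OF N(1)])
  qed
  have f_live: "\<exists>w\<in>carrier M. f N \<odot>\<^bsub>M\<^esub> w \<noteq> \<zero>\<^bsub>M\<^esub>" if N: "N \<in> S" for N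
    using N fc[OF N] f_out[OF N] unfolding S_def by blast
  have "finite S"
  proof -
    obtain Ps where Ps: "\<And>P. P \<in> set Ps \<Longrightarrow> primeideal P R" "{\<zero>} = ideal_prod_list R Ps"
      using R.ZPI_prime_product[OF zpiR R.zeroideal] by blast
    have "S \<subseteq> set Ps"
    proof
      fix N assume N: "N \<in> S"
      have "ideal_prod_list R Ps \<subseteq> N"
        unfolding Ps(2)[symmetric] using additive_subgroup.zero_closed[OF ideal.axioms(1)[OF id[OF N]]]
        by simp
      then obtain P where "P \<in> set Ps" "P \<subseteq> N"
        using R.prime_contains_factor[OF prime[OF N], of Ps] Ps(1) R.ideal_if_prime by blast
      then show "N \<in> set Ps" using min[OF N] Ps(1) unfolding R.minimal_prime_def by blast
    qed
    then show ?thesis using finite_subset by blast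
  qed
  \<comment> \<open>A vector that vanishes at \<open>N\<close> is corrected by a vector of the component at \<open>N\<close>. By
    orthogonality this does not change the other components.\<close>
  have "\<exists>x\<in>carrier M. \<forall>N\<in>F. f N \<odot>\<^bsub>M\<^esub> x \<noteq> \<zero>\<^bsub>M\<^esub>" if "finite F" "F \<subseteq> S" for F
    using that
  proof (induct F rule: finite_induct)
    case empty
    then show ?case using M.zero_closed by blast
  next
    case (insert N F)
    then obtain x where x: "x \<in> carrier M" "\<forall>N\<in>F. f N \<odot>\<^bsub>M\<^esub> x \<noteq> \<zero>\<^bsub>M\<^esub>" by blast
    have N: "N \<in> S" using insert by blast
    show ?case
    proof (cases "f N \<odot>\<^bsub>M\<^esub> x = \<zero>\<^bsub>M\<^esub>")
      case True
      obtain w where w: "w \<in> carrier M" "f N \<odot>\<^bsub>M\<^esub> w \<noteq> \<zero>\<^bsub>M\<^esub>" using f_live[OF N] by blast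
      let ?x = "x \<oplus>\<^bsub>M\<^esub> f N \<odot>\<^bsub>M\<^esub> w"
      have "f N \<otimes> f N = f N"
        unfolding f_def using R.idempotent_generator_compl(2)[OF id[OF N] e(1)[OF N]] e(2)[OF N] by blast
      then have "f N \<odot>\<^bsub>M\<^esub> ?x = f N \<odot>\<^bsub>M\<^esub> w"
        using x(1) w(1) fc[OF N] True by (simp add: smult_r_distr smult_assoc1[symmetric])
      moreover have "f N' \<odot>\<^bsub>M\<^esub> ?x = f N' \<odot>\<^bsub>M\<^esub> x" if N': "N' \<in> F" for N'
      proof -
        have "N' \<in> S" "N' \<noteq> N" using N' insert by blast+
        then show ?thesis
          using orth[of N' N] N x(1) w(1) fc[OF N] fc[of N']
          by (simp add: smult_r_distr smult_assoc1[symmetric])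
      qed
      moreover have "?x \<in> carrier M" using x(1) w(1) fc[OF N] by simp
      ultimately show ?thesis using w(2) x(2) by (intro bexI[of _ ?x]) auto
    qed (use x in blast)
  qed
  from this[OF \<open>finite S\<close> subset_refl] obtain x
    where x: "x \<in> carrier M" "\<And>N. N \<in> S \<Longrightarrow> f N \<odot>\<^bsub>M\<^esub> x \<noteq> \<zero>\<^bsub>M\<^esub>" by blast
  have torsion: "\<exists>s\<in>carrier R - N. s \<odot>\<^bsub>M\<^esub> y = \<zero>\<^bsub>M\<^esub>"
    if "maximalideal N R" "N \<notin> S" "y \<in> carrier M" for N y
    using that unfolding S_def by blast
  have gen: "\<exists>r\<in>carrier R. y = r \<odot>\<^bsub>M\<^esub> x" if y: "y \<in> carrier M" for y
  proof (rule local_membership[OF x(1) y])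
    fix N assume N: "maximalideal N R"
    show "\<exists>s\<in>carrier R - N. \<exists>r\<in>carrier R. s \<odot>\<^bsub>M\<^esub> y = r \<odot>\<^bsub>M\<^esub> x"
    proof (cases "N \<in> S")
      case True
      then have "\<exists>r\<in>carrier R. f N \<odot>\<^bsub>M\<^esub> y = r \<odot>\<^bsub>M\<^esub> x"
        using simple[OF True x(1) y] x(2)[OF True] unfolding f_def by blast
      then show ?thesis using fc[OF True] f_out[OF True] by blast
    next
      case False
      then obtain s where s: "s \<in> carrier R - N" "s \<odot>\<^bsub>M\<^esub> y = \<zero>\<^bsub>M\<^esub>"
        using torsion[OF N _ y] by blast
      then have "s \<odot>\<^bsub>M\<^esub> y = \<zero> \<odot>\<^bsub>M\<^esub> x" using x(1) by simp
      then show ?thesis using s(1) R.zero_closed by blast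
    qed
  qed
  have cyc: "cyclic_module R M"
    unfolding cyclic_module_def using gen x(1) module_axioms by (auto intro!: bexI[of _ x])
  obtain Ns where Ns: "set Ns = S" using finite_list[OF \<open>finite S\<close>] by blast
  have prod: "ideal_prod_list R Ns = {a \<in> carrier R. \<forall>N\<in>set Ns. a \<in> N}"
    using id e Ns by (intro R.ideal_prod_list_idempotent_generators) blast
  have "annihilator R M = ideal_prod_list R Ns"
  proof
    show "annihilator R M \<subseteq> ideal_prod_list R Ns"
    proof
      fix a assume "a \<in> annihilator R M"
      then have a: "a \<in> carrier R" "a \<odot>\<^bsub>M\<^esub> x = \<zero>\<^bsub>M\<^esub>" using x(1) unfolding annihilator_def by auto
      have "a \<in> N" if N: "N \<in> S" for N
      proof (rule ccontr)
        assume "a \<notin> N"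
        then obtain n c where nc: "n \<in> N" "c \<in> carrier R" "n \<oplus> c \<otimes> a = \<one>"
          using R.maximalideal_one_decomp[OF max[OF N] a(1)] by blast
        have ncarr: "n \<in> carrier R" using ideal.Icarr[OF id[OF N] nc(1)] .
        have "f N = f N \<otimes> (n \<oplus> c \<otimes> a)" using nc(3) fc[OF N] by simp
        also have "\<dots> = (f N \<otimes> c) \<otimes> a"
          using fn[OF N nc(1)] fc[OF N] nc(2) a(1) ncarr by (simp add: R.r_distr R.m_assoc)
        finally have "f N \<odot>\<^bsub>M\<^esub> x = (f N \<otimes> c) \<odot>\<^bsub>M\<^esub> (a \<odot>\<^bsub>M\<^esub> x)"
          using fc[OF N] nc(2) a(1) x(1) smult_assoc1[of "f N \<otimes> c" a x] by simp
        also have "\<dots> = \<zero>\<^bsub>M\<^esub>" using a(2) fc[OF N] nc(2) by simp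
        finally show False using x(2)[OF N] by simp
      qed
      then show "a \<in> ideal_prod_list R Ns" unfolding prod Ns using a(1) by blast
    qed
    show "ideal_prod_list R Ns \<subseteq> annihilator R M"
    proof
      fix a assume "a \<in> ideal_prod_list R Ns"
      then have a: "a \<in> carrier R" "\<And>N. N \<in> S \<Longrightarrow> a \<in> N" unfolding prod Ns by auto
      have "a \<odot>\<^bsub>M\<^esub> y = \<zero>\<^bsub>M\<^esub>" if y: "y \<in> carrier M" for y
      proof -
        have "\<exists>r\<in>carrier R. a \<odot>\<^bsub>M\<^esub> y = r \<odot>\<^bsub>M\<^esub> \<zero>\<^bsub>M\<^esub>"
        proof (rule local_membership)
          show "\<zero>\<^bsub>M\<^esub> \<in> carrier M" "a \<odot>\<^bsub>M\<^esub> y \<in> carrier M" using a(1) y by simp_all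
          fix N assume N: "maximalideal N R"
          have "\<exists>s\<in>carrier R - N. s \<odot>\<^bsub>M\<^esub> (a \<odot>\<^bsub>M\<^esub> y) = \<zero>\<^bsub>M\<^esub>"
          proof (cases "N \<in> S")
            case True
            have "f N \<odot>\<^bsub>M\<^esub> (a \<odot>\<^bsub>M\<^esub> y) = \<zero>\<^bsub>M\<^esub>"
              using fn[OF True a(2)[OF True]] fc[OF True] a(1) y by (simp add: smult_assoc1[symmetric])
            then show ?thesis using fc[OF True] f_out[OF True] by blast
          qed (use torsion[OF N] a(1) y in blast)
          then show "\<exists>s\<in>carrier R - N. \<exists>r\<in>carrier R. s \<odot>\<^bsub>M\<^esub> (a \<odot>\<^bsub>M\<^esub> y) = r \<odot>\<^bsub>M\<^esub> \<zero>\<^bsub>M\<^esub>"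
            using R.zero_closed smult_r_null by metis
        qed
        then show ?thesis by auto
      qed
      then show "a \<in> annihilator R M" using a(1) unfolding annihilator_def by blast
    qed
  qed
  moreover have "idempotent_ideal N R" if N: "N \<in> S" for N
  proof -
    have "n \<in> N \<cdot> N" if n: "n \<in> N" for n
      using ideal_prod.prod[OF e(1)[OF N] n, of R] e(2)[OF N n] by simp
    then show ?thesis
      unfolding idempotent_ideal_def using id[OF N] R.ideal_prod_subset_left[OF id[OF N] id[OF N]] by blast
  qed
  ultimately show ?thesis using cyc Ns max by blast
qed

section \<open>Trivial extensions by cyclic modules\<close>

text \<open>In general \<open>(Q \<times> M)(C \<times> M)\<close> is \<open>QC \<times> (QM + CM)\<close>. An element \<open>h\<close> of \<open>Q\<close> that acts as the
  identity makes the second component all of \<open>M\<close>.\<close>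

lemma lift_ideal_prod:
  assumes Q: "ideal Q R" and C: "ideal C R"
    and h: "h \<in> Q" "\<And>x. x \<in> carrier M \<Longrightarrow> h \<odot>\<^bsub>M\<^esub> x = x"
  shows "(Q \<times> carrier M) \<cdot>\<^bsub>T\<^esub> (C \<times> carrier M) = (Q \<cdot> C) \<times> carrier M" (is "?L = ?R")
proof
  note Qc = ideal.Icarr[OF Q] and Cc = ideal.Icarr[OF C]
  have QC: "ideal (Q \<cdot> C) R" by (rule R.ideal_prod_is_ideal[OF Q C])
  have zC: "\<zero> \<in> C" by (rule additive_subgroup.zero_closed[OF ideal.axioms(1)[OF C]])
  have L: "ideal ?L T" by (rule T.ideal_prod_is_ideal[OF lift_ideal[OF Q] lift_ideal[OF C]])
  show "?L \<subseteq> ?R"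
    by (rule T.ideal_prod_subset[OF lift_ideal[OF QC]]) (use Qc Cc in \<open>auto intro!: ideal_prod.prod\<close>)
  have ker: "(\<zero>, z) \<in> ?L" if z: "z \<in> carrier M" for z
  proof -
    have "(h, \<zero>\<^bsub>M\<^esub>) \<otimes>\<^bsub>T\<^esub> (\<zero>, z) \<in> ?L"
      using h(1) zC z by (intro ideal_prod.prod) auto
    then show ?thesis using h(2)[OF z] Qc[OF h(1)] z by simp
  qed
  have coord: "(i, \<zero>\<^bsub>M\<^esub>) \<in> ?L" if "i \<in> Q \<cdot> C" for i
    using that
  proof induct
    case (prod q c)
    then have "(q, \<zero>\<^bsub>M\<^esub>) \<otimes>\<^bsub>T\<^esub> (c, \<zero>\<^bsub>M\<^esub>) \<in> ?L"
      by (intro ideal_prod.prod) auto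
    then show ?case using prod Qc Cc by simp
  next
    case (sum s t)
    then have "(s, \<zero>\<^bsub>M\<^esub>) \<oplus>\<^bsub>T\<^esub> (t, \<zero>\<^bsub>M\<^esub>) \<in> ?L" by (intro ideal_prod.sum)
    then show ?case by simp
  qed
  show "?R \<subseteq> ?L"
  proof
    fix s assume "s \<in> ?R"
    then obtain i z where s: "s = (i, z)" "i \<in> Q \<cdot> C" "z \<in> carrier M" by blast
    have "(i, \<zero>\<^bsub>M\<^esub>) \<oplus>\<^bsub>T\<^esub> (\<zero>, z) \<in> ?L" by (rule ideal_prod.sum[OF coord[OF s(2)] ker[OF s(3)]])
    then show "s \<in> ?L" using s ideal.Icarr[OF QC s(2)] by simp
  qed
qed

lemma lift_prime_product:
  assumes Ps: "\<And>P. P \<in> set Ps \<Longrightarrow> primeideal P R"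
    and h: "\<And>P. P \<in> set Ps \<Longrightarrow> h \<in> P" "\<And>x. x \<in> carrier M \<Longrightarrow> h \<odot>\<^bsub>M\<^esub> x = x"
  shows "prime_product T (ideal_prod_list R Ps \<times> carrier M)"
  using Ps h(1)
proof (induct Ps)
  case Nil
  show ?case unfolding prime_product_def by (rule exI[of _ "[]"]) simp
next
  case (Cons P Ps)
  have id: "ideal P R" "ideal (ideal_prod_list R Ps) R"
    using Cons.prems(1) R.ideal_if_prime by (auto intro!: R.ideal_prod_list_ideal)
  have "prime_product T ((P \<times> carrier M) \<cdot>\<^bsub>T\<^esub> (ideal_prod_list R Ps \<times> carrier M))"
    using Cons T.prime_product_prime[OF lift_primeideal] by (intro T.prime_product_mult) auto
  then show ?case using lift_ideal_prod[OF id _ h(2)] Cons.prems(2) by simp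
qed

text \<open>The product \<open>g\<close> of the \<open>e N\<close> annihilates \<open>M\<close>, and \<open>(1 - g, 0)\<close> is in \<open>J\<close>, since \<open>1 - g\<close> is a
  combination of the \<open>1 - e N\<close>. As \<open>1 - g\<close> acts on \<open>M\<close> as the identity, \<open>J\<close> contains \<open>0 \<times> M\<close> and
  comes from an ideal of \<open>R\<close>. All prime factors of that ideal contain \<open>1 - g\<close>, so its factorization
  lifts to \<open>T\<close>.\<close>

lemma prime_product_if_contains_complements:
  assumes zpi: "general_ZPI_ring R" and J: "ideal J T"
    and e: "\<And>N. N \<in> set Ns \<Longrightarrow> ideal N R \<and> e N \<in> N \<and> (\<one> \<ominus> e N, \<zero>\<^bsub>M\<^esub>) \<in> J"
    and ann: "ideal_prod_list R Ns \<subseteq> annihilator R M"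
  shows "prime_product T J"
proof -
  have "\<exists>g\<in>ideal_prod_list R Ns. (\<one> \<ominus> g, \<zero>\<^bsub>M\<^esub>) \<in> J"
    using e
  proof (induct Ns)
    case Nil
    have "(\<one> \<ominus> \<one>, \<zero>\<^bsub>M\<^esub>) = \<zero>\<^bsub>T\<^esub>" by (simp add: R.minus_eq R.r_neg)
    then have "(\<one> \<ominus> \<one>, \<zero>\<^bsub>M\<^esub>) \<in> J"
      using additive_subgroup.zero_closed[OF ideal.axioms(1)[OF J]] by metis
    then show ?case by (intro bexI[of _ \<one>]) auto
  next
    case (Cons N Ns)
    then obtain g where g: "g \<in> ideal_prod_list R Ns" "(\<one> \<ominus> g, \<zero>\<^bsub>M\<^esub>) \<in> J" by auto
    have N: "ideal N R" "e N \<in> N" "(\<one> \<ominus> e N, \<zero>\<^bsub>M\<^esub>) \<in> J" using Cons.prems[of N] by auto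
    have idN: "ideal (ideal_prod_list R Ns) R" using Cons.prems by (auto intro!: R.ideal_prod_list_ideal)
    have c: "e N \<in> carrier R" "g \<in> carrier R" using ideal.Icarr[OF N(1,2)] ideal.Icarr[OF idN g(1)] by auto
    have "(\<one> \<ominus> e N, \<zero>\<^bsub>M\<^esub>) \<oplus>\<^bsub>T\<^esub> (e N, \<zero>\<^bsub>M\<^esub>) \<otimes>\<^bsub>T\<^esub> (\<one> \<ominus> g, \<zero>\<^bsub>M\<^esub>) \<in> J"
      using c by (intro additive_subgroup.a_closed[OF ideal.axioms(1)[OF J]] N ideal.I_l_closed[OF J g(2)]) auto
    moreover have "(\<one> \<ominus> e N) \<oplus> e N \<otimes> (\<one> \<ominus> g) = \<one> \<ominus> e N \<otimes> g"
      using c by (simp add: R.minus_eq R.r_distr R.r_minus R.a_assoc R.r_neg1)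
    ultimately have "(\<one> \<ominus> e N \<otimes> g, \<zero>\<^bsub>M\<^esub>) \<in> J" using c by simp
    moreover have "e N \<otimes> g \<in> ideal_prod_list R (N # Ns)" using N g by (auto intro: ideal_prod.prod)
    ultimately show ?case by blast
  qed
  then obtain g where g: "g \<in> annihilator R M" "(\<one> \<ominus> g, \<zero>\<^bsub>M\<^esub>) \<in> J" using ann by blast
  have gc: "g \<in> carrier R" using g(1) unfolding annihilator_def by blast
  have hx: "(\<one> \<ominus> g) \<odot>\<^bsub>M\<^esub> x = x" if x: "x \<in> carrier M" for x
    using g(1) x smult_one_minus[OF gc x] unfolding annihilator_def by simp
  have "{\<zero>} \<times> carrier M \<subseteq> J"
  proof
    fix s assume "s \<in> {\<zero>} \<times> carrier M"
    then obtain x where x: "s = (\<zero>, x)" "x \<in> carrier M" by blast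
    have "(\<one> \<ominus> g, \<zero>\<^bsub>M\<^esub>) \<otimes>\<^bsub>T\<^esub> (\<zero>, x) \<in> J" using x by (intro ideal.I_r_closed[OF J g(2)]) simp
    then show "s \<in> J" using x gc hx by simp
  qed
  then have Jeq: "J = fst ` J \<times> carrier M" by (rule ideal_T_eq_lift[OF J])
  have "ideal (fst ` J) R" by (rule fst.ring.ideal_image[OF fst_surj J])
  then obtain Qs where Qs: "\<And>P. P \<in> set Qs \<Longrightarrow> primeideal P R" "fst ` J = ideal_prod_list R Qs"
    using R.ZPI_prime_product[OF zpi] by blast
  have "\<one> \<ominus> g \<in> fst ` J" using g(2) by force
  then have "\<one> \<ominus> g \<in> P" if "P \<in> set Qs" for P
    using R.ideal_prod_list_subset_member[of Qs P] Qs that R.ideal_if_prime by blast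
  then have "prime_product T (ideal_prod_list R Qs \<times> carrier M)"
    using Qs(1) hx by (intro lift_prime_product) auto
  then show ?thesis using Jeq Qs(2) by simp
qed

text \<open>With \<open>f = 1 - e\<close> and \<open>k = R/N\<close>, an ideal containing \<open>(e, 0)\<close> is given by an ideal of the
  component of \<open>T\<close> at \<open>f\<close>, which is the field \<open>k\<close> extended by \<open>fM\<close>, a vector space over \<open>k\<close> of
  dimension at most 1 because \<open>M\<close> is cyclic. The ideals of that component are the unit ideal, \<open>0 \<times> fM\<close>,
  and 0. They correspond to \<open>T\<close>, \<open>N \<times> M\<close>, and its square.\<close>

lemma ideal_containing_idempotent_cases:
  assumes Y: "ideal Y T" and N: "maximalideal N R"
    and e: "e \<in> N" "\<And>n. n \<in> N \<Longrightarrow> e \<otimes> n = n" and eY: "(e, \<zero>\<^bsub>M\<^esub>) \<in> Y"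
    and cyc: "cyclic_module R M"
  shows "Y = carrier T \<or> Y = N \<times> carrier M \<or> Y = (N \<times> carrier M) \<cdot>\<^bsub>T\<^esub> (N \<times> carrier M)"
proof -
  have N': "ideal N R" using N by (rule maximalideal.axioms(1))
  note Nc = ideal.Icarr[OF N']
  define NN where "NN = N \<times> carrier M"
  have NN: "ideal NN T" unfolding NN_def by (rule lift_ideal[OF N'])
  have ec: "e \<in> carrier R" by (rule Nc[OF e(1)])
  define f where "f = \<one> \<ominus> e"
  have fc: "f \<in> carrier R" using ec by (simp add: f_def)
  have fn: "f \<otimes> n = \<zero>" if "n \<in> N" for n
    unfolding f_def by (rule R.idempotent_generator_compl(1)[OF N' e that])
  have add: "\<And>s t. s \<in> Y \<Longrightarrow> t \<in> Y \<Longrightarrow> s \<oplus>\<^bsub>T\<^esub> t \<in> Y"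
    by (rule additive_subgroup.a_closed[OF ideal.axioms(1)[OF Y]])
  have nY: "(n, \<zero>\<^bsub>M\<^esub>) \<in> Y" if n: "n \<in> N" for n
  proof -
    have "(n, \<zero>\<^bsub>M\<^esub>) \<otimes>\<^bsub>T\<^esub> (e, \<zero>\<^bsub>M\<^esub>) \<in> Y" using Nc[OF n] by (intro ideal.I_l_closed[OF Y eY]) simp
    then show ?thesis using Nc[OF n] ec e(2)[OF n] by (simp add: R.m_comm)
  qed
  show ?thesis
  proof (cases "Y \<subseteq> NN")
    case False
    then obtain b y where b: "(b, y) \<in> Y" "(b, y) \<notin> NN" by auto
    have "(b, y) \<in> carrier T" by (rule ideal.Icarr[OF Y b(1)])
    then have bc: "b \<in> carrier R" "y \<in> carrier M" "b \<notin> N" using b(2) by (auto simp: NN_def)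
    obtain n c where nc: "n \<in> N" "c \<in> carrier R" "n \<oplus> c \<otimes> b = \<one>"
      using R.maximalideal_one_decomp[OF N bc(1,3)] by blast
    have "(n, \<zero>\<^bsub>M\<^esub>) \<oplus>\<^bsub>T\<^esub> (c, \<zero>\<^bsub>M\<^esub>) \<otimes>\<^bsub>T\<^esub> (b, y) \<in> Y"
      using nc(2) by (intro add nY[OF nc(1)] ideal.I_l_closed[OF Y b(1)]) simp
    then have cy: "(\<one>, c \<odot>\<^bsub>M\<^esub> y) \<in> Y" using nc bc by simp
    have "(\<one>, \<ominus>\<^bsub>M\<^esub> (c \<odot>\<^bsub>M\<^esub> y)) \<otimes>\<^bsub>T\<^esub> (\<one>, c \<odot>\<^bsub>M\<^esub> y) \<in> Y"
      using nc(2) bc by (intro ideal.I_l_closed[OF Y cy]) simp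
    then have "\<one>\<^bsub>T\<^esub> \<in> Y" using nc(2) bc by (simp add: M.r_neg)
    then show ?thesis using ideal.one_imp_carrier[OF Y] by blast
  next
    case YNN: True
    have sq: "NN \<cdot>\<^bsub>T\<^esub> NN \<subseteq> Y"
    proof (rule T.ideal_prod_subset[OF Y])
      fix s t assume "s \<in> NN" "t \<in> NN"
      then obtain n x m y where st: "s = (n, x)" "t = (m, y)" "n \<in> N" "m \<in> N" "x \<in> carrier M" "y \<in> carrier M"
        unfolding NN_def by blast
      have c: "n \<in> carrier R" "m \<in> carrier R" using st Nc by auto
      have "(e, \<zero>\<^bsub>M\<^esub>) \<otimes>\<^bsub>T\<^esub> (s \<otimes>\<^bsub>T\<^esub> t) \<in> Y"
        using st c by (intro ideal.I_r_closed[OF Y eY]) simp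
      moreover have "(e, \<zero>\<^bsub>M\<^esub>) \<otimes>\<^bsub>T\<^esub> (s \<otimes>\<^bsub>T\<^esub> t) = s \<otimes>\<^bsub>T\<^esub> t"
        using st c ec e(2)[OF st(3)] e(2)[OF st(4)]
        by (simp add: smult_r_distr smult_assoc1[symmetric] R.m_assoc[symmetric])
      ultimately show "s \<otimes>\<^bsub>T\<^esub> t \<in> Y" by simp
    qed
    show ?thesis
    proof (cases "Y \<subseteq> NN \<cdot>\<^bsub>T\<^esub> NN")
      case True
      then show ?thesis using sq unfolding NN_def by blast
    next
      case False
      then obtain s where s: "s \<in> Y" "s \<notin> NN \<cdot>\<^bsub>T\<^esub> NN" by blast
      then obtain p x where px: "s = (p, x)" "p \<in> N" "x \<in> carrier M" using YNN unfolding NN_def by blast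
      have pc: "p \<in> carrier R" by (rule Nc[OF px(2)])
      have split: "e \<odot>\<^bsub>M\<^esub> z \<oplus>\<^bsub>M\<^esub> f \<odot>\<^bsub>M\<^esub> z = z" if z: "z \<in> carrier M" for z
        unfolding f_def using smult_one_minus[OF ec z] ec z
        by (simp add: M.a_ac M.r_neg M.r_neg1 M.r_neg2)
      have fx: "f \<odot>\<^bsub>M\<^esub> x \<noteq> \<zero>\<^bsub>M\<^esub>"
      proof
        assume "f \<odot>\<^bsub>M\<^esub> x = \<zero>\<^bsub>M\<^esub>"
        then have "e \<odot>\<^bsub>M\<^esub> x = x" using split[OF px(3)] ec px(3) by simp
        then have "(e, \<zero>\<^bsub>M\<^esub>) \<otimes>\<^bsub>T\<^esub> s = s" using px ec pc e(2)[OF px(2)] by simp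
        moreover have "(e, \<zero>\<^bsub>M\<^esub>) \<otimes>\<^bsub>T\<^esub> s \<in> NN \<cdot>\<^bsub>T\<^esub> NN"
          using px e(1) unfolding NN_def by (intro ideal_prod.prod) auto
        ultimately show False using s(2) by simp
      qed
      have "(f, \<zero>\<^bsub>M\<^esub>) \<otimes>\<^bsub>T\<^esub> s \<in> Y" using fc by (intro ideal.I_l_closed[OF Y s(1)]) simp
      then have fxY: "(\<zero>, f \<odot>\<^bsub>M\<^esub> x) \<in> Y" using px pc fc fn[OF px(2)] by simp
      obtain w where w: "w \<in> carrier M" "carrier M = {a \<odot>\<^bsub>M\<^esub> w | a. a \<in> carrier R}"
        using cyc unfolding cyclic_module_def by blast
      obtain a where a: "a \<in> carrier R" "x = a \<odot>\<^bsub>M\<^esub> w" using px(3) w(2) by blast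
      have "a \<notin> N"
      proof
        assume "a \<in> N"
        then have "f \<odot>\<^bsub>M\<^esub> x = \<zero>\<^bsub>M\<^esub>"
          using fn a fc w(1) by (simp add: smult_assoc1[symmetric])
        then show False using fx by simp
      qed
      then obtain n c where nc: "n \<in> N" "c \<in> carrier R" "n \<oplus> c \<otimes> a = \<one>"
        using R.maximalideal_one_decomp[OF N a(1)] by blast
      have fzY: "(\<zero>, f \<odot>\<^bsub>M\<^esub> z) \<in> Y" if z: "z \<in> carrier M" for z
      proof -
        obtain r where r: "r \<in> carrier R" "z = r \<odot>\<^bsub>M\<^esub> w" using z w(2) by blast
        have "f = f \<otimes> (n \<oplus> c \<otimes> a)" using nc(3) fc by simp
        also have "\<dots> = f \<otimes> (c \<otimes> a)"
          using fn[OF nc(1)] fc nc(2) a(1) Nc[OF nc(1)] by (simp add: R.r_distr)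
        finally have "f \<odot>\<^bsub>M\<^esub> z = (f \<otimes> (c \<otimes> a)) \<odot>\<^bsub>M\<^esub> (r \<odot>\<^bsub>M\<^esub> w)" using r(2) by simp
        also have "\<dots> = (f \<otimes> (c \<otimes> a) \<otimes> r) \<odot>\<^bsub>M\<^esub> w"
          using fc nc(2) a(1) r(1) w(1) smult_assoc1[of "f \<otimes> (c \<otimes> a)" r w] by simp
        also have "f \<otimes> (c \<otimes> a) \<otimes> r = (r \<otimes> c) \<otimes> (f \<otimes> a)"
          using fc nc(2) a(1) r(1) by (simp add: R.m_ac)
        also have "((r \<otimes> c) \<otimes> (f \<otimes> a)) \<odot>\<^bsub>M\<^esub> w = (r \<otimes> c) \<odot>\<^bsub>M\<^esub> (f \<odot>\<^bsub>M\<^esub> x)"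
          using fc nc(2) a r(1) w(1) by (simp add: smult_assoc1)
        finally have eq: "f \<odot>\<^bsub>M\<^esub> z = (r \<otimes> c) \<odot>\<^bsub>M\<^esub> (f \<odot>\<^bsub>M\<^esub> x)" .
        have "(r \<otimes> c, \<zero>\<^bsub>M\<^esub>) \<otimes>\<^bsub>T\<^esub> (\<zero>, f \<odot>\<^bsub>M\<^esub> x) \<in> Y"
          using r(1) nc(2) by (intro ideal.I_l_closed[OF Y fxY]) simp
        then show ?thesis unfolding eq using r(1) nc(2) fc px(3) by simp
      qed
      have "NN \<subseteq> Y"
      proof
        fix t assume "t \<in> NN"
        then obtain q z where t: "t = (q, z)" "q \<in> N" "z \<in> carrier M" unfolding NN_def by blast
        have qc: "q \<in> carrier R" by (rule Nc[OF t(2)])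
        have "(e, \<zero>\<^bsub>M\<^esub>) \<otimes>\<^bsub>T\<^esub> t \<oplus>\<^bsub>T\<^esub> (\<zero>, f \<odot>\<^bsub>M\<^esub> z) \<in> Y"
          using t qc by (intro add fzY ideal.I_r_closed[OF Y eY]) simp_all
        moreover have "(e, \<zero>\<^bsub>M\<^esub>) \<otimes>\<^bsub>T\<^esub> t \<oplus>\<^bsub>T\<^esub> (\<zero>, f \<odot>\<^bsub>M\<^esub> z) = t"
          using t qc ec fc e(2)[OF t(2)] split[OF t(3)] by simp
        ultimately show "t \<in> Y" by simp
      qed
      then show ?thesis using YNN unfolding NN_def by blast
    qed
  qed
qed

text \<open>By induction on \<open>F\<close>, the claim holds for ideals that contain \<open>(1 - e P, 0)\<close> for all \<open>P\<close> outside
  \<open>F\<close>. To treat an ideal \<open>J\<close> that may lack this element for one more \<open>N\<close>, split off the component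
  at \<open>N\<close>.\<close>

lemma cyclic_imp_ZPI_T:
  assumes ne: "\<one> \<noteq> \<zero>" and zpi: "general_ZPI_ring R" and cyc: "cyclic_module R M"
    and Ps: "\<And>P. P \<in> set Ps \<Longrightarrow> maximalideal P R \<and> idempotent_ideal P R"
    and ann: "annihilator R M = ideal_prod_list R Ps"
  shows "general_ZPI_ring T"
proof -
  have id: "ideal P R" if "P \<in> set Ps" for P using Ps[OF that] maximalideal.axioms(1) by blast
  have "\<exists>e\<in>P. \<forall>m\<in>P. e \<otimes> m = m" if "P \<in> set Ps" for P
    using R.ZPI_idempotent_maximal_generator[OF zpi] Ps[OF that] by blast
  then obtain e where e: "\<And>P. P \<in> set Ps \<Longrightarrow> e P \<in> P"
      "\<And>P m. P \<in> set Ps \<Longrightarrow> m \<in> P \<Longrightarrow> e P \<otimes> m = m" by metis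
  have ec: "e P \<in> carrier R" if "P \<in> set Ps" for P using ideal.Icarr[OF id[OF that] e(1)[OF that]] .
  have "prime_product T J"
    if "F \<subseteq> set Ps" "ideal J T" "\<And>P. P \<in> set Ps - F \<Longrightarrow> (\<one> \<ominus> e P, \<zero>\<^bsub>M\<^esub>) \<in> J" for F J
  proof -
    have "finite F" using that(1) finite_subset by blast
    then show ?thesis using that
    proof (induct F arbitrary: J rule: finite_induct)
      case empty
      then show ?case
        using id e(1) ann by (intro prime_product_if_contains_complements[OF zpi, of J Ps e]) auto
    next
      case (insert N F)
      have N: "N \<in> set Ps" using insert.prems(1) by blast
      note J = insert.prems(2)
      note compl = R.idempotent_generator_compl[OF id[OF N] e(1)[OF N] e(2)[OF N]]
      define p where "p = (\<one> \<ominus> e N, \<zero>\<^bsub>M\<^esub>)"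
      have p: "p \<in> carrier T" "p \<otimes>\<^bsub>T\<^esub> p = p" using ec[OF N] compl(2) by (simp_all add: p_def)
      have q: "\<one>\<^bsub>T\<^esub> \<ominus>\<^bsub>T\<^esub> p = (e N, \<zero>\<^bsub>M\<^esub>)"
      proof -
        have "(e N, \<zero>\<^bsub>M\<^esub>) \<oplus>\<^bsub>T\<^esub> p = \<one>\<^bsub>T\<^esub>"
          using ec[OF N] by (simp add: p_def R.minus_eq R.a_ac R.r_neg R.r_neg1 R.r_neg2)
        then have "\<one>\<^bsub>T\<^esub> \<ominus>\<^bsub>T\<^esub> p = ((e N, \<zero>\<^bsub>M\<^esub>) \<oplus>\<^bsub>T\<^esub> p) \<ominus>\<^bsub>T\<^esub> p" by simp
        also have "\<dots> = (e N, \<zero>\<^bsub>M\<^esub>) \<oplus>\<^bsub>T\<^esub> (p \<ominus>\<^bsub>T\<^esub> p)"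
          using p(1) ec[OF N] T.a_assoc[of "(e N, \<zero>\<^bsub>M\<^esub>)" p "\<ominus>\<^bsub>T\<^esub> p"] T.a_inv_closed[OF p(1)]
          unfolding T.minus_eq by (simp del: T_simps(3))
        also have "p \<ominus>\<^bsub>T\<^esub> p = \<zero>\<^bsub>T\<^esub>" unfolding T.minus_eq by (rule T.r_neg[OF p(1)])
        also have "(e N, \<zero>\<^bsub>M\<^esub>) \<oplus>\<^bsub>T\<^esub> \<zero>\<^bsub>T\<^esub> = (e N, \<zero>\<^bsub>M\<^esub>)" using ec[OF N] by simp
        finally show ?thesis .
      qed
      have qT: "(e N, \<zero>\<^bsub>M\<^esub>) \<in> carrier T" using ec[OF N] by simp
      let ?X = "J <+>\<^bsub>T\<^esub> PIdl\<^bsub>T\<^esub> p" and ?Y = "J <+>\<^bsub>T\<^esub> PIdl\<^bsub>T\<^esub> (e N, \<zero>\<^bsub>M\<^esub>)"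
      have idl: "ideal (PIdl\<^bsub>T\<^esub> p) T" "ideal (PIdl\<^bsub>T\<^esub> (e N, \<zero>\<^bsub>M\<^esub>)) T"
        by (rule T.cgenideal_ideal[OF p(1)], rule T.cgenideal_ideal[OF qT])
      have X: "ideal ?X T" and Y: "ideal ?Y T" by (rule T.add_ideals[OF J idl(1)], rule T.add_ideals[OF J idl(2)])
      have JX: "J \<subseteq> ?X" "PIdl\<^bsub>T\<^esub> p \<subseteq> ?X"
        by (rule T.subset_set_add_left[OF J idl(1)], rule T.subset_set_add_right[OF J idl(1)])
      have "prime_product T ?X"
      proof (rule insert.hyps(3))
        show "F \<subseteq> set Ps" using insert.prems(1) by blast
        show "ideal ?X T" by (rule X)
        fix P assume P: "P \<in> set Ps - F"
        show "(\<one> \<ominus> e P, \<zero>\<^bsub>M\<^esub>) \<in> ?X"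
        proof (cases "P = N")
          case True
          then show ?thesis using T.cgenideal_self[OF p(1)] JX(2) unfolding p_def by blast
        next
          case False
          then have "(\<one> \<ominus> e P, \<zero>\<^bsub>M\<^esub>) \<in> J" using P by (intro insert.prems(3)) blast
          then show ?thesis using JX(1) by blast
        qed
      qed
      moreover have "prime_product T ?Y"
      proof -
        have Np: "primeideal (N \<times> carrier M) T"
          using lift_primeideal R.maximalideal_prime Ps[OF N] by blast
        have eY: "(e N, \<zero>\<^bsub>M\<^esub>) \<in> ?Y"
          using T.cgenideal_self[OF qT] T.subset_set_add_right[OF J idl(2)] by blast
        have "?Y = carrier T \<or> ?Y = N \<times> carrier M \<or> ?Y = (N \<times> carrier M) \<cdot>\<^bsub>T\<^esub> (N \<times> carrier M)"
          using Ps[OF N] by (intro ideal_containing_idempotent_cases[OF Y _ e(1)[OF N] e(2)[OF N] eY cyc]) auto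
        moreover have "prime_product T (carrier T)"
          unfolding prime_product_def by (rule exI[of _ "[]"]) simp
        ultimately show ?thesis
          using T.prime_product_prime[OF Np] T.prime_product_mult by metis
      qed
      ultimately have "prime_product T (?X \<cdot>\<^bsub>T\<^esub> ?Y)" by (rule T.prime_product_mult)
      then show ?case using T.ideal_split_idempotent[OF J p] unfolding q by simp
    qed
  qed
  from this[OF subset_refl] show ?thesis
    unfolding T.general_ZPI_ring_iff using ne by auto
qed

end

section \<open>Trivial extensions that are OAF-rings\<close>

theorem theorem4p4:
  fixes A :: "('a, 'm) ring_scheme"
    and E :: "('a, 'b, 'k) module_scheme"
    and n :: nat
  assumes "cring A" and "\<one>\<^bsub>A\<^esub> \<noteq> \<zero>\<^bsub>A\<^esub>"
    and "\<not> local_ring A"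
    and "module A E"
    and "n \<ge> 1"
  shows "n_OAF_ring n (trivial_extension A E) \<longleftrightarrow>
    general_ZPI_ring A \<and>
    ((cyclic_module A E \<and>
      (\<exists>Ps. (\<forall>P\<in>set Ps. maximalideal P A \<and> idempotent_ideal P A) \<and>
            annihilator A E = ideal_prod_list A Ps)) \<or>
     carrier E = {\<zero>\<^bsub>E\<^esub>})"
proof -
  interpret module A E by fact
  interpret T: cring T by (rule T_cring)
  obtain d d' where d: "d \<in> carrier A - Units A" "d' \<in> carrier A - Units A" "d \<oplus>\<^bsub>A\<^esub> d' = \<one>\<^bsub>A\<^esub>"
    using R.not_local_imp_nonunits_sum_one[OF assms(2,3)] by blast
  have "(d, \<zero>\<^bsub>E\<^esub>) \<oplus>\<^bsub>T\<^esub> (d', \<zero>\<^bsub>E\<^esub>) = \<one>\<^bsub>T\<^esub>" using d(3) by simp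
  then have OAF: "n_OAF_ring n T \<longleftrightarrow> general_ZPI_ring T"
    by (rule T.n_OAF_ring_iff_general_ZPI_ring[OF lift_nonunit[OF d(1)] lift_nonunit[OF d(2)] _ assms(5)])
  have zero: "cyclic_module A E \<and> annihilator A E = ideal_prod_list A []" if "carrier E = {\<zero>\<^bsub>E\<^esub>}"
    using that module_axioms unfolding cyclic_module_def annihilator_def
    by (auto intro!: exI[of _ "\<one>\<^bsub>A\<^esub>"])
  show ?thesis
  proof
    assume "n_OAF_ring n T"
    then have zpi: "general_ZPI_ring T" using OAF by blast
    show "general_ZPI_ring A \<and> ((cyclic_module A E \<and>
        (\<exists>Ps. (\<forall>P\<in>set Ps. maximalideal P A \<and> idempotent_ideal P A) \<and>
            annihilator A E = ideal_prod_list A Ps)) \<or> carrier E = {\<zero>\<^bsub>E\<^esub>})"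
      using ZPI_base_if_ZPI_T[OF assms(2) zpi] ZPI_T_imp_cyclic[OF assms(2) zpi] by blast
  next
    assume r: "general_ZPI_ring A \<and> ((cyclic_module A E \<and>
        (\<exists>Ps. (\<forall>P\<in>set Ps. maximalideal P A \<and> idempotent_ideal P A) \<and>
            annihilator A E = ideal_prod_list A Ps)) \<or> carrier E = {\<zero>\<^bsub>E\<^esub>})"
    have "\<exists>Ps. (\<forall>P\<in>set Ps. maximalideal P A \<and> idempotent_ideal P A) \<and>
            cyclic_module A E \<and> annihilator A E = ideal_prod_list A Ps"
    proof (cases "carrier E = {\<zero>\<^bsub>E\<^esub>}")
      case True
      then show ?thesis using zero by (intro exI[of _ "[]"]) simp
    qed (use r in blast)
    then have "general_ZPI_ring T" using cyclic_imp_ZPI_T[OF assms(2)] r by blast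
    then show "n_OAF_ring n T" using OAF by blast
  qed
qed

end
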